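(* Let $p>q$ be primes. (1) If $p\not\equiv 1\pmod q$, then up to isomorphism there is only one skew brace of size $pq$, the trivial one. (2) If $p\equiv 1\pmod q$, let $g$ be a fixed element of $\mathbb{Z}_p$ of multiplicative order $q$. Then a complete list of the $2q+2$ skew braces of order $pq$, up to isomorphism, is the following, where in each case the underlying set is $A=\mathbb{Z}_p\times\mathbb{Z}_q$, with elements written as columns $\begin{pmatrix} n\\ m\end{pmatrix}$ with $n\in\mathbb{Z}_p$, $m\in\mathbb{Z}_q$. (a) Additive group $\mathbb{Z}_p\times\mathbb{Z}_q$, that is, $$\begin{pmatrix} n \\ m \end{pmatrix} + \begin{pmatrix} s \\ t \end{pmatrix} =\begin{pmatrix} n+s \\ m+t \end{pmatrix}:$$ (i) the trivial skew brace over $\mathbb{Z}_p\times\mathbb{Z}_q$; (ii) the bi-skew brace $(A,+,\circ)$ where $$\begin{pmatrix} n \\ m \end{pmatrix} \circ \begin{pmatrix} s \\ t \end{pmatrix} =\begin{pmatrix} n+g^{m}s \\ m+t \end{pmatrix}.$$ (b) Additive group $\mathbb{Z}_p\rtimes_g\mathbb{Z}_q$, that is, $$\begin{pmatrix} n \\ m \end{pmatrix} + \begin{pmatrix} s \\ t \end{pmatrix} =\begin{pmatrix} n+g^{m}s \\ m+t \end{pmatrix}:$$ (i) the trivial skew brace over $\mathbb{Z}_p\rtimes_g\mathbb{Z}_q$; (ii) the skew brace $(A,+,\circ)$ where $$\begin{pmatrix} n \\ m \end{pmatrix} \circ \begin{pmatrix} s \\ t \end{pmatrix} =\begin{pmatrix}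 g^t n+g^{m}s \\ m+t \end{pmatrix};$$ (iii) the bi-skew braces $A_\gamma=(A,+,\circ)$ for integers $1<\gamma\leq q$, where $$\begin{pmatrix} n \\ m \end{pmatrix} \circ \begin{pmatrix} s \\ t \end{pmatrix} =\begin{pmatrix} n+\left(g^{\gamma}\right)^m s \\ m+t \end{pmatrix};$$ (iv) the skew braces $A_\mu=(A,+,\circ)$ for integers $1<\mu\leq q$, where $$\begin{pmatrix} n \\ m \end{pmatrix} \circ \begin{pmatrix} s \\ t \end{pmatrix} =\begin{pmatrix} g^t n+\left(g^{\mu}\right)^m s \\ m+t \end{pmatrix}.$$
   Context: A skew (left) brace is a triple $(A,+,\circ)$ where $(A,+)$ and $(A,\circ)$ are groups (not necessarily abelian, even though the first is written additively) such that $a\circ(b+c)=a\circ b-a+a\circ c$ for all $a,b,c\in A$; its size (or order) is $|A|$, and its additive group is $(A,+)$. An isomorphism of skew braces is a bijection that is a homomorphism for both operations. A skew brace is trivial if $a+b=a\circ b$ for all $a,b\in A$; the trivial skew brace over a group $G$ is the one with both operations equal to that of $G$. A bi-skew brace is a skew brace $(A,+,\circ)$ such that $(A,\circ,+)$ is also a skew brace. Since $g$ has multiplicative order $q$ modulo $p$, the powers $g^m$ with $m\in\mathbb{Z}_q$ are well defined in $\mathbb{Z}_p$. "Complete list up to isomorphism" means that every skew brace of order $pq$ is isomorphic to exactly one in the list. *)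

theory Defs
  imports
    "HOL-Algebra.Elementary_Groups"
    "HOL-Algebra.Ring"
    "HOL-Number_Theory.Number_Theory"
begin

text \<open>
  A skew brace \<open>(A, +, \<circ>)\<close> is carried by a ring record: \<open>\<oplus>\<close> is the (possibly noncommutative)
  additive group operation and \<open>\<otimes>\<close> is the circle operation. The library's \<open>x \<ominus> y\<close> unfolds to
  \<open>x \<oplus> m_inv (add_monoid A) y\<close>, so it does not presuppose commutativity. Both
  \<open>a \<otimes> b \<ominus> a \<oplus> a \<otimes> c\<close> and its informal counterpart associate to the left.
\<close>

locale skew_brace =
  fixes A (structure)
  assumes additive_group: "group (add_monoid A)"
    and circle_group: "group A"
    and brace_law: "\<lbrakk>a \<in> carrier A; b \<in> carrier A; c \<in> carrier A\<rbrakk>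
      \<Longrightarrow> a \<otimes> (b \<oplus> c) = (a \<otimes> b) \<ominus> a \<oplus> (a \<otimes> c)"

definition swap_ops :: "'a ring \<Rightarrow> 'a ring" where
  "swap_ops A = \<lparr>carrier = carrier A, monoid.mult = ring.add A, monoid.one = ring.zero A, ring.zero = monoid.one A, ring.add = monoid.mult A\<rparr>"

definition bi_skew_brace :: "'a ring \<Rightarrow> bool" where
  "bi_skew_brace A \<longleftrightarrow> skew_brace A \<and> skew_brace (swap_ops A)"

definition trivial_skew_brace :: "'a ring \<Rightarrow> bool" where
  "trivial_skew_brace A \<longleftrightarrow>
     skew_brace A \<and> (\<forall>a\<in>carrier A. \<forall>b\<in>carrier A. a \<oplus>\<^bsub>A\<^esub> b = a \<otimes>\<^bsub>A\<^esub> b)"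

definition skew_brace_iso :: "'a ring \<Rightarrow> 'b ring \<Rightarrow> ('a \<Rightarrow> 'b) set" where
  "skew_brace_iso A B = iso (add_monoid A) (add_monoid B) \<inter> iso A B"

definition isomorphic_skew_braces :: "'a ring \<Rightarrow> 'b ring \<Rightarrow> bool" (infix \<open>\<cong>\<^sub>b\<close> 50) where
  "A \<cong>\<^sub>b B \<longleftrightarrow> skew_brace_iso A B \<noteq> {}"

definition brace_on :: "'a monoid \<Rightarrow> ('a \<Rightarrow> 'a \<Rightarrow> 'a) \<Rightarrow> 'a ring" where
  "brace_on G circ = \<lparr>carrier = carrier G, monoid.mult = circ, monoid.one = monoid.one G, ring.zero = monoid.one G, ring.add = monoid.mult G\<rparr>"

definition trivial_brace_on :: "'a monoid \<Rightarrow> 'a ring" where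
  "trivial_brace_on G = brace_on G (monoid.mult G)"

text \<open>
  \<open>\<int>\<^sub>n\<close> is represented by the residues \<open>{0..<n}\<close>, the carrier of \<open>integer_mod_group n\<close>. A power
  \<open>g\<^sup>m\<close> with \<open>m \<in> \<int>\<^sub>q\<close> is taken at the representative \<open>m \<in> {0..<q}\<close>; modulo \<open>p\<close> the choice
  of representative is irrelevant whenever \<open>h\<^sup>q \<equiv> 1\<close> for the base \<open>h\<close>.
\<close>

abbreviation direct_group :: "nat \<Rightarrow> nat \<Rightarrow> (int \<times> int) monoid" where
  "direct_group p q \<equiv> integer_mod_group p \<times>\<times> integer_mod_group q"

definition semidirect_op ::
    "nat \<Rightarrow> nat \<Rightarrow> int \<Rightarrow> int \<times> int \<Rightarrow> int \<times> int \<Rightarrow> int \<times> int" where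
  "semidirect_op p q h = (\<lambda>(n, m) (s, t).
     ((n + h ^ nat m * s) mod int p, (m + t) mod int q))"

definition twisted_op ::
    "nat \<Rightarrow> nat \<Rightarrow> int \<Rightarrow> int \<Rightarrow> int \<times> int \<Rightarrow> int \<times> int \<Rightarrow> int \<times> int" where
  "twisted_op p q g h = (\<lambda>(n, m) (s, t).
     ((g ^ nat t * n + h ^ nat m * s) mod int p, (m + t) mod int q))"

definition semidirect_group :: "nat \<Rightarrow> nat \<Rightarrow> int \<Rightarrow> (int \<times> int) monoid" where
  "semidirect_group p q g =
     \<lparr>carrier = carrier (direct_group p q), monoid.mult = semidirect_op p q g, monoid.one = (0, 0)\<rparr>"

definition brace_a_i :: "nat \<Rightarrow> nat \<Rightarrow> (int \<times> int) ring" where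
  "brace_a_i p q = trivial_brace_on (direct_group p q)"

definition brace_a_ii :: "nat \<Rightarrow> nat \<Rightarrow> int \<Rightarrow> (int \<times> int) ring" where
  "brace_a_ii p q g = brace_on (direct_group p q) (semidirect_op p q g)"

definition brace_b_i :: "nat \<Rightarrow> nat \<Rightarrow> int \<Rightarrow> (int \<times> int) ring" where
  "brace_b_i p q g = trivial_brace_on (semidirect_group p q g)"

definition brace_b_ii :: "nat \<Rightarrow> nat \<Rightarrow> int \<Rightarrow> (int \<times> int) ring" where
  "brace_b_ii p q g = brace_on (semidirect_group p q g) (twisted_op p q g g)"

definition brace_b_iii :: "nat \<Rightarrow> nat \<Rightarrow> int \<Rightarrow> nat \<Rightarrow> (int \<times> int) ring" where
  "brace_b_iii p q g \<gamma> = brace_on (semidirect_group p q g) (semidirect_op p q (g ^ \<gamma>))"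

definition brace_b_iv :: "nat \<Rightarrow> nat \<Rightarrow> int \<Rightarrow> nat \<Rightarrow> (int \<times> int) ring" where
  "brace_b_iv p q g \<mu> = brace_on (semidirect_group p q g) (twisted_op p q g (g ^ \<mu>))"

definition pq_braces :: "nat \<Rightarrow> nat \<Rightarrow> int \<Rightarrow> (int \<times> int) ring list" where
  "pq_braces p q g =
     [brace_a_i p q, brace_a_ii p q g, brace_b_i p q g, brace_b_ii p q g]
     @ map (brace_b_iii p q g) [2..<Suc q]
     @ map (brace_b_iv p q g) [2..<Suc q]"

end

(*
  The subgroup P of order p is characteristic in (A,+), hence stable under every
  lam a = (b |-> -a + a o b), and it is the subgroup of order p of (A,o) as well.
  Let s generate P and let t have additive order q.  All of s o t, t o s, t + s and
  lam t s are determined by exponents modulo p; comparing lam (t o s) with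
  lam t (lam s t) forces s o t = s + t or s o t = t + s.  The second case becomes the
  first for the opposite brace (A,+op,o).  In the first case t can be translated by an
  element of P so that lam t t = t; then additive and circle multiples of s and of t agree
  and (n,m) |-> n s + m t identifies A with Z_p x Z_q carrying two semidirect products,
  with parameters h and k satisfying h^q = k^q = 1.  Undoing the passage to the opposite
  brace gives the operations with the extra factor g^t.  The parameters are unique up to
  replacing t by a multiple, that is, up to raising all of them to one common power.
*)

theory Submission
  imports Defs "HOL-Algebra.Sylow"
begin

section \<open>Models on \<open>\<int>\<^sub>p \<times> \<int>\<^sub>q\<close>\<close>

text \<open>The obstacle is that an element t of additive order q is guaranteed neither to have
  circle order q nor to be fixed by P, whereas a coordinate map must respect both groups at once.
  This is why t is corrected by an element of P before any coordinates are introduced. The factor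
  \<open>g^t\<close> has this origin. In the opposite brace the additive parameter ends up on the
  wrong side: in its coordinates the original addition is \<open>twisted_op h 1\<close>. The map (n,
  m) to (h^m n, m) multiplies both parameters of a \<open>twisted_op\<close> by h. Undoing it turns
  the addition into \<open>twisted_op 1 h'\<close> with h' inverse to h, and the circle operation
  acquires h' as its left parameter. Hence the alternative \<open>a = 1\<close> or
  \<open>a = h\<close> in the models. The number 2q + 2 counts triples (h, a, k) of q-th roots of
  unity up to a common power. If h = 1, then a = 1 and k can be normalised to 1 or g, which gives 2
  braces. Otherwise h can be normalised to g; no freedom is left then, so a has 2 values and k has
  q.\<close>

definition twisted_monoid :: "nat \<Rightarrow> nat \<Rightarrow> int \<Rightarrow> int \<Rightarrow> (int \<times> int) monoid" where
  "twisted_monoid p q a b =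
     \<lparr>carrier = {0..<int p} \<times> {0..<int q}, monoid.mult = twisted_op p q a b, monoid.one = (0, 0)\<rparr>"

text \<open>Both kinds of braces in the list: \<open>a = 1\<close> gives two semidirect products, \<open>a = h\<close> the
  circle operation with the extra factor \<open>g\<^sup>t\<close>.\<close>

definition model_brace :: "nat \<Rightarrow> nat \<Rightarrow> int \<Rightarrow> int \<Rightarrow> int \<Rightarrow> (int \<times> int) ring" where
  "model_brace p q h a k = brace_on (twisted_monoid p q 1 h) (twisted_op p q a k)"

lemma twisted_op_simp:
  "twisted_op p q a b (n, m) (s, t) =
     ((a ^ nat t * n + b ^ nat m * s) mod int p, (m + t) mod int q)"
  by (simp add: twisted_op_def)

lemma twisted_monoid_simps [simp]:
  "carrier (twisted_monoid p q a b) = {0..<int p} \<times> {0..<int q}"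
  "monoid.mult (twisted_monoid p q a b) = twisted_op p q a b"
  "monoid.one (twisted_monoid p q a b) = (0, 0)"
  by (simp_all add: twisted_monoid_def)

lemma model_brace_simps [simp]:
  "carrier (model_brace p q h a k) = {0..<int p} \<times> {0..<int q}"
  "monoid.mult (model_brace p q h a k) = twisted_op p q a k"
  "monoid.one (model_brace p q h a k) = (0, 0)"
  "ring.zero (model_brace p q h a k) = (0, 0)"
  "ring.add (model_brace p q h a k) = twisted_op p q 1 h"
  by (simp_all add: model_brace_def brace_on_def)

lemma pow_nat_mod_cong:
  fixes h :: int
  assumes "[h ^ q = 1] (mod int p)" and "m \<ge> 0"
  shows "[h ^ nat (m mod int q) = h ^ nat m] (mod int p)"
proof -
  have "h ^ nat m = (h ^ q) ^ (nat m div q) * h ^ (nat m mod q)"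
    by (simp flip: power_add power_mult)
  moreover have "[(h ^ q) ^ (nat m div q) * h ^ (nat m mod q) = 1 ^ (nat m div q) * h ^ (nat m mod q)] (mod int p)"
    by (intro cong_mult cong_pow assms cong_refl)
  moreover have "nat (m mod int q) = nat m mod q"
    using assms(2) by (simp add: nat_mod_distrib)
  ultimately show ?thesis
    by (simp add: cong_sym)
qed

text \<open>This makes m to h^m a homomorphism from Z_q, which is what the group and brace laws need
  when second coordinates wrap around.\<close>

lemma pow_nat_add_mod_cong:
  fixes h :: int
  assumes "[h ^ q = 1] (mod int p)" and "m \<ge> 0" and "t \<ge> 0"
  shows "[h ^ nat ((m + t) mod int q) = h ^ nat m * h ^ nat t] (mod int p)"
  using pow_nat_mod_cong[OF assms(1), of "m + t"] assms by (simp add: nat_add_distrib power_add)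

text \<open>Z_q acts on Z_p from the right through \<open>a\<close> and from the left through
  \<open>b\<close>, and associativity holds because the two actions commute. The map (n, m) to
  (a^(-m) n, m) identifies this group with the semidirect product of parameter b/a; in particular it
  is abelian for a = b.\<close>

lemma group_twisted_monoid:
  assumes "p > 0" and "q > 0" and a: "[a ^ q = 1] (mod int p)" and b: "[b ^ q = 1] (mod int p)"
  shows "group (twisted_monoid p q a b)"
proof (rule groupI)
  fix x y z
  assume "x \<in> carrier (twisted_monoid p q a b)" "y \<in> carrier (twisted_monoid p q a b)"
    "z \<in> carrier (twisted_monoid p q a b)"
  then obtain n m s t u v where xyz: "x = (n, m)" "y = (s, t)" "z = (u, v)"
    and ge: "m \<ge> 0" "t \<ge> 0" "v \<ge> 0"
    by (cases x; cases y; cases z) auto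
  have "[a ^ nat v * ((a ^ nat t * n + b ^ nat m * s) mod int p) + b ^ nat ((m + t) mod int q) * u
     = a ^ nat v * (a ^ nat t * n + b ^ nat m * s) + (b ^ nat m * b ^ nat t) * u] (mod int p)"
    by (intro cong_add cong_mult cong_refl pow_nat_add_mod_cong b ge) (simp add: cong_def)
  also have "a ^ nat v * (a ^ nat t * n + b ^ nat m * s) + (b ^ nat m * b ^ nat t) * u
     = (a ^ nat t * a ^ nat v) * n + b ^ nat m * (a ^ nat v * s + b ^ nat t * u)"
    by (simp add: algebra_simps)
  also have "[\<dots> = a ^ nat ((t + v) mod int q) * n
      + b ^ nat m * ((a ^ nat v * s + b ^ nat t * u) mod int p)] (mod int p)"
    by (rule cong_sym, intro cong_add cong_mult cong_refl pow_nat_add_mod_cong a ge)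
      (simp add: cong_def)
  finally show "x \<otimes>\<^bsub>twisted_monoid p q a b\<^esub> y \<otimes>\<^bsub>twisted_monoid p q a b\<^esub> z
      = x \<otimes>\<^bsub>twisted_monoid p q a b\<^esub> (y \<otimes>\<^bsub>twisted_monoid p q a b\<^esub> z)"
    by (simp add: xyz twisted_op_simp cong_def mod_add_left_eq mod_add_right_eq add.assoc)
next
  fix x
  assume "x \<in> carrier (twisted_monoid p q a b)"
  then obtain n m where x: "x = (n, m)" and m: "0 \<le> m" "m < int q"
    by (cases x) auto
  \<comment> \<open>The left inverse of (n, m) is (s, -m) with a^m s + b^(-m) n = 0; this is solved
    for s.\<close>
  define s where "s = - (a ^ nat ((- m) mod int q) * b ^ nat ((- m) mod int q) * n)"
  have inv: "[c ^ nat m * c ^ nat ((- m) mod int q) = 1] (mod int p)"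
    if "[c ^ q = 1] (mod int p)" for c
  proof -
    have "(m + (- m) mod int q) mod int q = 0"
      by (simp add: mod_add_right_eq)
    then show ?thesis
      using pow_nat_add_mod_cong[OF that, of m "(- m) mod int q"] m \<open>q > 0\<close> by (simp add: cong_sym)
  qed
  have "[a ^ nat m * (s mod int p) + b ^ nat ((- m) mod int q) * n
     = a ^ nat m * s + b ^ nat ((- m) mod int q) * n] (mod int p)"
    by (intro cong_add cong_mult cong_refl) (simp add: cong_def)
  also have "a ^ nat m * s + b ^ nat ((- m) mod int q) * n =
     (1 - a ^ nat m * a ^ nat ((- m) mod int q)) * (b ^ nat ((- m) mod int q) * n)"
    by (simp add: s_def algebra_simps)
  also have "[\<dots> = (1 - 1) * (b ^ nat ((- m) mod int q) * n)] (mod int p)"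
    by (intro cong_diff cong_mult cong_refl inv a)
  finally have "twisted_op p q a b (s mod int p, (- m) mod int q) x = (0, 0)"
    by (simp add: x twisted_op_simp cong_def mod_add_left_eq)
  then show "\<exists>y\<in>carrier (twisted_monoid p q a b).
      y \<otimes>\<^bsub>twisted_monoid p q a b\<^esub> x = \<one>\<^bsub>twisted_monoid p q a b\<^esub>"
    using \<open>p > 0\<close> \<open>q > 0\<close> by (intro bexI[of _ "(s mod int p, (- m) mod int q)"]) auto
qed (use assms in \<open>auto simp: twisted_op_simp\<close>)

text \<open>Carries the group property over to a ring record, which has another record type than
  \<open>twisted_monoid\<close>.\<close>

lemma group_cong_ops:
  assumes "group G" and "carrier H = carrier G" and "monoid.mult H = monoid.mult G"
    and "monoid.one H = monoid.one G"
  shows "group H"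
proof -
  interpret group G by fact
  show ?thesis
    by (rule groupI) (simp_all add: assms(2-) m_assoc l_inv_ex)
qed

lemma skew_brace_model_brace:
  assumes pq: "p > 0" "q > 0"
    and h: "[h ^ q = 1] (mod int p)" and k: "[k ^ q = 1] (mod int p)" and a: "a = 1 \<or> a = h"
  shows "skew_brace (model_brace p q h a k)"
proof (rule skew_brace.intro)
  have a': "[a ^ q = 1] (mod int p)"
    using a h by auto
  have add: "add_monoid (model_brace p q h a k) = twisted_monoid p q 1 h"
    by (simp add: twisted_monoid_def)
  interpret add: group "add_monoid (model_brace p q h a k)"
    unfolding add using pq h by (simp add: group_twisted_monoid)
  show "group (add_monoid (model_brace p q h a k))" ..
  show "group (model_brace p q h a k)"
    by (rule group_cong_ops[OF group_twisted_monoid[OF pq a' k]]) simp_all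
  fix x y z
  assume xyz: "x \<in> carrier (model_brace p q h a k)" "y \<in> carrier (model_brace p q h a k)"
    "z \<in> carrier (model_brace p q h a k)"
  then obtain n m s t u v where xyz': "x = (n, m)" "y = (s, t)" "z = (u, v)"
    and m: "m \<ge> 0" and t: "t \<ge> 0" and v: "v \<ge> 0" and tq: "t < int q"
    by (cases x; cases y; cases z) auto
  \<comment> \<open>\<open>w\<close> is the difference of \<open>x \<otimes> y\<close> and
    \<open>x\<close>, found by solving w + x = x o y. With it the brace law reads x o (y + z) = w +
    (x o z).\<close>
  define w where "w = (((a ^ nat t - h ^ nat t) * n + k ^ nat m * s) mod int p, t)"
  have w: "w \<in> carrier (model_brace p q h a k)"
    using pq t tq by (auto simp: w_def)
  have "x \<otimes>\<^bsub>model_brace p q h a k\<^esub> y = w \<oplus>\<^bsub>model_brace p q h a k\<^esub> x"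
    by (simp add: xyz' w_def twisted_op_simp mod_add_left_eq mod_add_right_eq left_diff_distrib add.commute)
  then have "x \<otimes>\<^bsub>model_brace p q h a k\<^esub> y \<ominus>\<^bsub>model_brace p q h a k\<^esub> x = w"
    using add.inv_solve_right[of w "w \<oplus>\<^bsub>model_brace p q h a k\<^esub> x" x] add.m_closed[of w x] xyz w
    by (simp add: a_minus_def a_inv_def del: model_brace_simps)
  moreover have "x \<otimes>\<^bsub>model_brace p q h a k\<^esub> (y \<oplus>\<^bsub>model_brace p q h a k\<^esub> z)
     = w \<oplus>\<^bsub>model_brace p q h a k\<^esub> (x \<otimes>\<^bsub>model_brace p q h a k\<^esub> z)"
  proof -
    have "[a ^ nat ((t + v) mod int q) * n + k ^ nat m * ((s + h ^ nat t * u) mod int p)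
      = (a ^ nat t * a ^ nat v) * n + k ^ nat m * (s + h ^ nat t * u)] (mod int p)"
      by (intro cong_add cong_mult cong_refl pow_nat_add_mod_cong a' t v) (simp add: cong_def)
    also have "(a ^ nat t * a ^ nat v) * n + k ^ nat m * (s + h ^ nat t * u)
      = ((a ^ nat t - h ^ nat t) * n + k ^ nat m * s) + h ^ nat t * (a ^ nat v * n + k ^ nat m * u)
        + (a ^ nat t - h ^ nat t) * (a ^ nat v - 1) * n"
      by (simp add: algebra_simps)
    \<comment> \<open>This product times n is the whole defect of the brace law. The first factor
      vanishes for a = h, the second for a = 1.\<close>
    also have "(a ^ nat t - h ^ nat t) * (a ^ nat v - 1) = 0"
      using a by auto
    finally have "[a ^ nat ((t + v) mod int q) * n + k ^ nat m * ((s + h ^ nat t * u) mod int p)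
      = ((a ^ nat t - h ^ nat t) * n + k ^ nat m * s) + h ^ nat t * (a ^ nat v * n + k ^ nat m * u)] (mod int p)"
      by simp
    moreover have "[((a ^ nat t - h ^ nat t) * n + k ^ nat m * s) mod int p
         + h ^ nat t * ((a ^ nat v * n + k ^ nat m * u) mod int p)
      = ((a ^ nat t - h ^ nat t) * n + k ^ nat m * s) + h ^ nat t * (a ^ nat v * n + k ^ nat m * u)] (mod int p)"
      by (intro cong_add cong_mult cong_refl) (simp_all add: cong_def)
    ultimately have "(a ^ nat ((t + v) mod int q) * n + k ^ nat m * ((s + h ^ nat t * u) mod int p)) mod int p
      = (((a ^ nat t - h ^ nat t) * n + k ^ nat m * s) mod int p
         + h ^ nat t * ((a ^ nat v * n + k ^ nat m * u) mod int p)) mod int p"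
      by (simp add: cong_def)
    then show ?thesis
      by (simp add: xyz' w_def twisted_op_simp mod_add_right_eq add.left_commute)
  qed
  ultimately show "x \<otimes>\<^bsub>model_brace p q h a k\<^esub> (y \<oplus>\<^bsub>model_brace p q h a k\<^esub> z)
    = x \<otimes>\<^bsub>model_brace p q h a k\<^esub> y \<ominus>\<^bsub>model_brace p q h a k\<^esub> x
      \<oplus>\<^bsub>model_brace p q h a k\<^esub> (x \<otimes>\<^bsub>model_brace p q h a k\<^esub> z)"
    by simp
qed

lemma order_model_brace: "order (model_brace p q h a k) = p * q"
  by (simp add: order_def card_cartesian_product)

text \<open>For a = 1 both operations are semidirect products in the same coordinates, so exchanging
  them only exchanges the parameters; this is the source of all bi-skew braces in the list.\<close>

lemma swap_ops_model_brace: "swap_ops (model_brace p q h 1 k) = model_brace p q k 1 h"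
  by (simp add: swap_ops_def model_brace_def brace_on_def)

lemma bi_skew_brace_model_brace:
  assumes "p > 0" "q > 0" and "[h ^ q = 1] (mod int p)" and "[k ^ q = 1] (mod int p)"
  shows "bi_skew_brace (model_brace p q h 1 k)"
  using assms by (simp add: bi_skew_brace_def swap_ops_model_brace skew_brace_model_brace)

lemma trivial_model_brace:
  assumes "p > 0" "q > 0" and "[h ^ q = 1] (mod int p)"
  shows "trivial_skew_brace (model_brace p q h 1 h)"
  using assms by (simp add: trivial_skew_brace_def skew_brace_model_brace)

text \<open>All operations reduce modulo p, so congruent parameters give equal records and not
  merely isomorphic ones.\<close>

lemma model_brace_cong:
  assumes "[h = h'] (mod int p)" "[a = a'] (mod int p)" "[k = k'] (mod int p)"
  shows "model_brace p q h a k = model_brace p q h' a' k'"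
proof -
  have "twisted_op p q b c = twisted_op p q b' c'"
    if "[b = b'] (mod int p)" "[c = c'] (mod int p)" for b b' c c'
  proof -
    have "[b ^ j * n + c ^ i * s = b' ^ j * n + c' ^ i * s] (mod int p)" for i j n s
      by (intro cong_add cong_mult cong_pow cong_refl that)
    then show ?thesis
      by (auto simp: twisted_op_def cong_def)
  qed
  from this[of a a' k k'] this[of 1 1 h h'] show ?thesis
    using assms by (simp add: model_brace_def twisted_monoid_def)
qed

lemma semidirect_op_eq: "semidirect_op p q h = twisted_op p q 1 h"
  by (simp add: semidirect_op_def twisted_op_def)

lemma semidirect_group_eq:
  "p > 0 \<Longrightarrow> q > 0 \<Longrightarrow> semidirect_group p q h = twisted_monoid p q 1 h"
  by (simp add: semidirect_group_def twisted_monoid_def semidirect_op_eq carrier_integer_mod_group)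

lemma direct_group_eq:
  assumes "p > 0" "q > 0"
  shows "direct_group p q = twisted_monoid p q 1 1"
  using assms by (auto simp: DirProd_def twisted_monoid_def twisted_op_def carrier_integer_mod_group fun_eq_iff)

lemma pq_braces_eq:
  assumes "p > 0" "q > 0"
  shows "brace_a_i p q = model_brace p q 1 1 1"
    and "brace_a_ii p q g = model_brace p q 1 1 g"
    and "brace_b_i p q g = model_brace p q g 1 g"
    and "brace_b_ii p q g = model_brace p q g g g"
    and "brace_b_iii p q g \<gamma> = model_brace p q g 1 (g ^ \<gamma>)"
    and "brace_b_iv p q g \<gamma> = model_brace p q g g (g ^ \<gamma>)"
  using assms
  by (simp_all add: brace_a_i_def brace_a_ii_def brace_b_i_def brace_b_ii_def brace_b_iii_def
    brace_b_iv_def model_brace_def trivial_brace_on_def semidirect_op_eq semidirect_group_eq direct_group_eq)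

section \<open>Isomorphisms between models\<close>

lemma isomorphic_skew_bracesI:
  assumes "bij_betw f (carrier A) (carrier B)"
    and "\<And>x y. \<lbrakk>x \<in> carrier A; y \<in> carrier A\<rbrakk> \<Longrightarrow> f (x \<oplus>\<^bsub>A\<^esub> y) = f x \<oplus>\<^bsub>B\<^esub> f y"
    and "\<And>x y. \<lbrakk>x \<in> carrier A; y \<in> carrier A\<rbrakk> \<Longrightarrow> f (x \<otimes>\<^bsub>A\<^esub> y) = f x \<otimes>\<^bsub>B\<^esub> f y"
  shows "A \<cong>\<^sub>b B"
proof -
  have "f \<in> skew_brace_iso A B"
    using assms bij_betwE[OF assms(1)] by (auto simp: skew_brace_iso_def iso_def hom_def)
  then show ?thesis
    by (auto simp: isomorphic_skew_braces_def)
qed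

lemma isomorphic_skew_bracesE:
  assumes "A \<cong>\<^sub>b B"
  obtains f where "bij_betw f (carrier A) (carrier B)"
    and "\<And>x y. \<lbrakk>x \<in> carrier A; y \<in> carrier A\<rbrakk> \<Longrightarrow> f (x \<oplus>\<^bsub>A\<^esub> y) = f x \<oplus>\<^bsub>B\<^esub> f y"
    and "\<And>x y. \<lbrakk>x \<in> carrier A; y \<in> carrier A\<rbrakk> \<Longrightarrow> f (x \<otimes>\<^bsub>A\<^esub> y) = f x \<otimes>\<^bsub>B\<^esub> f y"
proof -
  obtain f where "f \<in> skew_brace_iso A B"
    using assms by (auto simp: isomorphic_skew_braces_def)
  then show thesis
    by (intro that[of f]) (auto simp: skew_brace_iso_def iso_def hom_def)
qed

lemma isomorphic_skew_braces_sym: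
  assumes "skew_brace A" and "A \<cong>\<^sub>b B"
  shows "B \<cong>\<^sub>b A"
proof -
  obtain f where f: "f \<in> iso (add_monoid A) (add_monoid B)" "f \<in> iso A B"
    using assms(2) by (auto simp: isomorphic_skew_braces_def skew_brace_iso_def)
  then have "inv_into (carrier A) f \<in> skew_brace_iso B A"
    using group.iso_set_sym[OF skew_brace.additive_group[OF assms(1)] f(1)]
      group.iso_set_sym[OF skew_brace.circle_group[OF assms(1)] f(2)]
    by (simp add: skew_brace_iso_def)
  then show ?thesis
    by (auto simp: isomorphic_skew_braces_def)
qed

lemma isomorphic_skew_braces_trans:
  assumes "A \<cong>\<^sub>b B" and "B \<cong>\<^sub>b C"
  shows "A \<cong>\<^sub>b C"
proof -
  obtain f g where "f \<in> skew_brace_iso A B" "g \<in> skew_brace_iso B C"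
    using assms by (auto simp: isomorphic_skew_braces_def)
  then have "g \<circ> f \<in> skew_brace_iso A C"
    unfolding skew_brace_iso_def by (meson IntD1 IntD2 IntI iso_set_trans)
  then show ?thesis
    by (auto simp: isomorphic_skew_braces_def)
qed

lemma trivial_skew_brace_iso:
  assumes "skew_brace A" and "A \<cong>\<^sub>b B" and "trivial_skew_brace B"
  shows "trivial_skew_brace A"
proof -
  obtain f where f: "bij_betw f (carrier A) (carrier B)"
    "\<And>x y. \<lbrakk>x \<in> carrier A; y \<in> carrier A\<rbrakk> \<Longrightarrow> f (x \<oplus>\<^bsub>A\<^esub> y) = f x \<oplus>\<^bsub>B\<^esub> f y"
    "\<And>x y. \<lbrakk>x \<in> carrier A; y \<in> carrier A\<rbrakk> \<Longrightarrow> f (x \<otimes>\<^bsub>A\<^esub> y) = f x \<otimes>\<^bsub>B\<^esub> f y"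
    using isomorphic_skew_bracesE[OF assms(2)] by blast
  interpret add: group "add_monoid A"
    by (rule skew_brace.additive_group) fact
  interpret circ: group A
    by (rule skew_brace.circle_group) fact
  have "x \<oplus>\<^bsub>A\<^esub> y = x \<otimes>\<^bsub>A\<^esub> y" if xy: "x \<in> carrier A" "y \<in> carrier A" for x y
  proof (rule inj_onD[OF bij_betw_imp_inj_on[OF f(1)]])
    show "f (x \<oplus>\<^bsub>A\<^esub> y) = f (x \<otimes>\<^bsub>A\<^esub> y)"
      using assms(3) bij_betwE[OF f(1)] xy by (simp add: f trivial_skew_brace_def)
  qed (use xy add.m_closed in auto)
  then show ?thesis
    using assms(1) by (simp add: trivial_skew_brace_def)
qed

lemma bij_betw_endo:
  assumes "finite S" and "\<And>x. x \<in> S \<Longrightarrow> f x \<in> S" and "inj_on f S"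
  shows "bij_betw f S S"
  unfolding bij_betw_def using assms endo_inj_surj[of S f] by blast

text \<open>The isomorphism is (n, m) to (n, j m): another generator of Z_q is chosen, which raises
  every parameter to the power j. It is injective because j is a unit modulo q.\<close>

lemma model_brace_rescale:
  assumes pq: "p > 0" "q > 0" and j: "coprime j q"
    and unity: "[h ^ q = 1] (mod int p)" "[a ^ q = 1] (mod int p)" "[k ^ q = 1] (mod int p)"
  shows "model_brace p q (h ^ j) (a ^ j) (k ^ j) \<cong>\<^sub>b model_brace p q h a k"
proof (rule isomorphic_skew_bracesI)
  define f :: "int \<times> int \<Rightarrow> int \<times> int" where "f = (\<lambda>(n, m). (n, int j * m mod int q))"
  have hom: "f (twisted_op p q (b ^ j) (c ^ j) x y) = twisted_op p q b c (f x) (f y)"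
    if b: "[b ^ q = 1] (mod int p)" and c: "[c ^ q = 1] (mod int p)"
      and xy: "x \<in> {0..<int p} \<times> {0..<int q}" "y \<in> {0..<int p} \<times> {0..<int q}" for b c x y
  proof -
    obtain n m s t where nm: "x = (n, m)" "y = (s, t)" "m \<ge> 0" "t \<ge> 0"
      using xy by (cases x; cases y) auto
    have pow: "[(d ^ j) ^ nat i = d ^ nat (int j * i mod int q)] (mod int p)"
      if "[d ^ q = 1] (mod int p)" "i \<ge> 0" for d i
      using cong_sym[OF pow_nat_mod_cong[OF that(1), of "int j * i"]] that(2)
      by (simp add: nat_mult_distrib power_mult)
    have "[(b ^ j) ^ nat t * n + (c ^ j) ^ nat m * s
        = b ^ nat (int j * t mod int q) * n + c ^ nat (int j * m mod int q) * s] (mod int p)"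
      by (intro cong_add cong_mult cong_refl pow b c nm)
    then show ?thesis
      by (simp add: nm f_def twisted_op_simp cong_def mod_add_left_eq mod_add_right_eq mod_mult_right_eq distrib_left)
  qed
  show "bij_betw f (carrier (model_brace p q (h ^ j) (a ^ j) (k ^ j))) (carrier (model_brace p q h a k))"
    unfolding model_brace_simps
  proof (rule bij_betw_endo)
    show "inj_on f ({0..<int p} \<times> {0..<int q})"
    proof (rule inj_onI)
      fix x y
      assume xy: "x \<in> {0..<int p} \<times> {0..<int q}" "y \<in> {0..<int p} \<times> {0..<int q}" "f x = f y"
      then have "[int j * snd x = int j * snd y] (mod int q)"
        by (simp add: f_def cong_def split_beta)
      then have "[snd x = snd y] (mod int q)"
        using j by (simp add: cong_mult_lcancel)
      then show "x = y"
        using xy by (cases x; cases y) (simp add: f_def cong_def)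
    qed
  qed (use pq in \<open>auto simp: f_def\<close>)
  show "f (x \<oplus>\<^bsub>model_brace p q (h ^ j) (a ^ j) (k ^ j)\<^esub> y) = f x \<oplus>\<^bsub>model_brace p q h a k\<^esub> f y"
    if "x \<in> carrier (model_brace p q (h ^ j) (a ^ j) (k ^ j))"
      "y \<in> carrier (model_brace p q (h ^ j) (a ^ j) (k ^ j))" for x y
    using hom[of 1 h x y] that unity by simp
  show "f (x \<otimes>\<^bsub>model_brace p q (h ^ j) (a ^ j) (k ^ j)\<^esub> y) = f x \<otimes>\<^bsub>model_brace p q h a k\<^esub> f y"
    if "x \<in> carrier (model_brace p q (h ^ j) (a ^ j) (k ^ j))"
      "y \<in> carrier (model_brace p q (h ^ j) (a ^ j) (k ^ j))" for x y
    using hom[of a k x y] that unity by simp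
qed

text \<open>With \<open>\<sigma> = (1, 0)\<close> and \<open>\<tau> = (0, 1)\<close>, the parameters are read off from
  \<open>\<tau> + \<sigma> = h \<sigma> + \<tau>\<close>, \<open>\<sigma> \<circ> \<tau> = a \<sigma> + \<tau>\<close> and \<open>\<tau> \<circ> \<sigma> = k \<sigma> + \<tau>\<close>.\<close>

lemma model_brace_iso_imp_powers:
  assumes p: "prime p" and q: "prime q" and "q < p"
    and iso: "model_brace p q h a k \<cong>\<^sub>b model_brace p q h' a' k'"
  obtains w where "[h' ^ w = h] (mod int p)" "[a' ^ w = a] (mod int p)" "[k' ^ w = k] (mod int p)"
proof -
  define S where "S = {0..<int p} \<times> {0..<int q}"
  have p1: "p > 1" and q1: "q > 1"
    using p q prime_gt_1_nat by blast+
  obtain f where bij: "bij_betw f S S"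
    and add: "\<And>x y. \<lbrakk>x \<in> S; y \<in> S\<rbrakk> \<Longrightarrow> f (twisted_op p q 1 h x y) = twisted_op p q 1 h' (f x) (f y)"
    and circ: "\<And>x y. \<lbrakk>x \<in> S; y \<in> S\<rbrakk> \<Longrightarrow> f (twisted_op p q a k x y) = twisted_op p q a' k' (f x) (f y)"
    using isomorphic_skew_bracesE[OF iso] unfolding model_brace_simps S_def by metis
  have f_S: "f x \<in> S" if "x \<in> S" for x
    using bij_betwE[OF bij] that by blast
  obtain u y where uy: "f (1, 0) = (u, y)" by fastforce
  obtain v w where vw: "f (0, 1) = (v, w)" by fastforce
  obtain r s where rs: "f (0, 0) = (r, s)" by fastforce
  have in_S: "(1, 0) \<in> S" "(0, 1) \<in> S" "(0, 0) \<in> S" "\<And>n. (n mod int p, 0) \<in> S"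
    using p1 q1 by (auto simp: S_def)
  have ranges: "0 \<le> u" "u < int p" "0 \<le> y" "y < int q" "0 \<le> v" "v < int p" "0 \<le> w" "w < int q"
      "0 \<le> r" "r < int p" "0 \<le> s" "s < int q"
    using f_S[OF in_S(1)] f_S[OF in_S(2)] f_S[OF in_S(3)] uy vw rs by (auto simp: S_def)
  \<comment> \<open>The image of an idempotent is idempotent. This gives s = 0, after which the
    twist disappears and r = 0 follows.\<close>
  have zero: "f (0, 0) = (0, 0)"
  proof -
    have eq: "(s + s) mod int q = s" "(r + h' ^ nat s * r) mod int p = r"
      using add[OF in_S(3) in_S(3)] by (simp_all add: twisted_op_simp rs)
    have "[s + s = 0 + s] (mod int q)"
      using eq(1) ranges by (simp add: cong_def)
    then have "s = 0"
      using ranges by (simp only: cong_add_rcancel) (simp add: cong_def)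
    moreover from this have "[r + r = 0 + r] (mod int p)"
      using eq(2) ranges by (simp add: cong_def)
    then have "r = 0"
      using ranges by (simp only: cong_add_rcancel) (simp add: cong_def)
    ultimately show ?thesis
      by (simp add: rs)
  qed
  have step: "f ((1 + n) mod int p, 0) = twisted_op p q 1 h' (u, y) (f (n mod int p, 0))" for n
    using add[OF in_S(1) in_S(4)[of n]] by (simp add: twisted_op_simp uy mod_simps)
  have snd_multiple: "snd (f (int n mod int p, 0)) = int n * y mod int q" for n
  proof (induction n)
    case (Suc n)
    obtain c d where "f (int n mod int p, 0) = (c, d)" by fastforce
    with Suc show ?case
      using step[of "int n"] by (simp add: twisted_op_simp mod_add_right_eq distrib_right)
  qed (simp add: zero)
  \<comment> \<open>Adding (1, 0) to itself p times returns to (0, 0), so p y = 0 in Z_q and y = 0: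
    \<open>f\<close> preserves Z_p x 0.\<close>
  have "int q dvd int p * y"
    using snd_multiple[of p] by (simp add: zero) presburger
  moreover have "coprime (int q) (int p)"
    using p q \<open>q < p\<close> by (simp add: primes_coprime)
  ultimately have "int q dvd y"
    by (simp add: coprime_dvd_mult_right_iff)
  then have y: "y = 0"
    using ranges zdvd_not_zless[of y "int q"] by linarith
  have multiple: "f (int n mod int p, 0) = (int n * u mod int p, 0)" for n
  proof (induction n)
    case (Suc n)
    then show ?case
      using step[of "int n"] by (simp add: twisted_op_simp mod_add_right_eq y distrib_right)
  qed (simp add: zero)
  have multiple_int: "f (n mod int p, 0) = (n * u mod int p, 0)" for n
    using multiple[of "nat (n mod int p)"] p1 by (simp add: mod_simps)
  have "u \<noteq> 0"
    using bij_betw_imp_inj_on[OF bij] in_S(1,3) zero uy y unfolding inj_on_def by force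
  then have u: "coprime u (int p)"
    using p ranges by (metis coprime_commute linorder_not_less order_le_less prime_imp_coprime
        prime_nat_int_transfer zdvd_not_zless)
  have cancel: "[c = b] (mod int p)" if "[c * u + v = b * u + v] (mod int p)" for b c
    using that u by (simp add: cong_add_rcancel cong_mult_rcancel)
  \<comment> \<open>Every element whose image is compared below has the form (n, 1), with n one of
    h, a, k. Its image computed here is set against the one from the homomorphism law;
    \<open>cancel\<close> then removes v and the unit u. The common exponent is \<open>w\<close>,
    the second coordinate of f(0, 1).\<close>
  have shifted: "f (n mod int p, 1) = ((n * u + v) mod int p, w)" for n
    using add[OF in_S(4)[of n] in_S(2)] q1 ranges
    by (simp add: twisted_op_simp vw multiple_int mod_simps)
  have "[h' ^ nat w * u + v = h * u + v] (mod int p)"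
    using add[OF in_S(2,1)] shifted[of h] q1 
    by (simp add: twisted_op_simp vw uy cong_def add.commute)
  moreover have "[a' ^ nat w * u + v = a * u + v] (mod int p)"
    using circ[OF in_S(1,2)] shifted[of a] q1 by (simp add: twisted_op_simp vw uy y cong_def)
  moreover have "[k' ^ nat w * u + v = k * u + v] (mod int p)"
    using circ[OF in_S(2,1)] shifted[of k] q1
    by (simp add: twisted_op_simp vw uy y cong_def add.commute)
  ultimately show thesis
    using that cancel by blast
qed

text \<open>Modulo a prime, z^q = 1 has at most q solutions, and the q distinct powers of g already
  exhaust them.\<close>

lemma unity_root_is_power:
  assumes p: "prime p" and q: "q > 1" and g: "ord p g = q" and x: "[x ^ q = 1] (mod int p)"
  obtains r where "r < q" "[x = int g ^ r] (mod int p)"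
proof -
  have p0: "p > 0" using p by (simp add: prime_gt_0_nat)
  define R where "R = {z \<in> {..<p}. [z ^ q = 1] (mod p)}"
  have cop: "coprime p g"
    using g q ord_eq_0[of p g] by auto
  have sub: "(\<lambda>r. g ^ r mod p) ` {..<q} \<subseteq> R"
  proof (rule image_subsetI)
    fix r
    have "[(g ^ q) ^ r = 1 ^ r] (mod p)"
      using ord[of g p] by (intro cong_pow) (simp add: g)
    then show "g ^ r mod p \<in> R"
      using p0 by (simp add: R_def cong_def mod_simps power_mult[symmetric] mult.commute)
  qed
  have "inj_on (\<lambda>r. g ^ r mod p) {..<q}"
    using order_divides_expdiff[OF cop] by (auto simp: inj_on_def cong_def g)
  then have "card ((\<lambda>r. g ^ r mod p) ` {..<q}) = q"
    by (simp add: card_image)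
  then have "(\<lambda>r. g ^ r mod p) ` {..<q} = R"
    using roots_mod_prime_bound[OF p, of q 1] q by (intro card_seteq sub) (auto simp: R_def)
  moreover have "nat (x mod int p) \<in> R"
  proof -
    have "[int (nat (x mod int p)) ^ q = x ^ q] (mod int p)"
      using p0 by (intro cong_pow) (simp add: cong_def)
    then have "[int (nat (x mod int p) ^ q) = int 1] (mod int p)"
      using cong_trans[OF _ x] by simp
    then show ?thesis
      using p0 unfolding R_def cong_int_iff by (simp add: nat_less_iff)
  qed
  ultimately obtain r where r: "r < q" "nat (x mod int p) = g ^ r mod p"
    by auto
  then have "x mod int p = int (g ^ r mod p)"
    using p0 by (metis int_nat_eq pos_mod_sign of_nat_0_less_iff)
  then show thesis
    using that[of r] r(1) by (simp add: cong_def zmod_int)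
qed

section \<open>Exponent triples and the isomorphism classes in the list\<close>

text \<open>The triple \<open>(i, l, j)\<close> encodes the exponents of \<open>g\<close> in \<open>model_brace p q (g ^ i) (g ^ l) (g ^ j)\<close>.\<close>

definition pq_params :: "nat \<Rightarrow> (nat \<times> nat \<times> nat) list" where
  "pq_params q = [(0, 0, 0), (0, 0, 1), (1, 0, 1), (1, 1, 1)]
     @ map (\<lambda>\<gamma>. (1, 0, \<gamma>)) [2..<Suc q] @ map (\<lambda>\<mu>. (1, 1, \<mu>)) [2..<Suc q]"

definition param_brace :: "nat \<Rightarrow> nat \<Rightarrow> int \<Rightarrow> nat \<times> nat \<times> nat \<Rightarrow> (int \<times> int) ring" where
  "param_brace p q g = (\<lambda>(i, l, j). model_brace p q (g ^ i) (g ^ l) (g ^ j))"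

lemma pq_braces_params:
  assumes "p > 0" "q > 0"
  shows "pq_braces p q g = map (param_brace p q g) (pq_params q)"
  using assms by (simp add: pq_braces_def pq_params_def param_brace_def pq_braces_eq)

text \<open>The braces \<open>brace_b_i\<close> and \<open>brace_b_ii\<close> supply the exponent 1
  missing from the ranges of \<gamma> and \<mu>. For each l the exponents j = 1, ..., q then
  represent every class modulo q once, with q in the place of 0.\<close>

lemma set_pq_params:
  "q > 1 \<Longrightarrow> x \<in> set (pq_params q) \<longleftrightarrow>
     x \<in> {(0, 0, 0), (0, 0, 1)} \<or> (\<exists>l j. x = (1, l, j) \<and> l \<le> 1 \<and> 1 \<le> j \<and> j \<le> q)"
  by (auto simp: pq_params_def image_iff le_Suc_eq)

lemma distinct_pq_params: "distinct (pq_params q)"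
  by (auto simp: pq_params_def distinct_map inj_on_def)

lemma length_pq_params: "q > 1 \<Longrightarrow> length (pq_params q) = 2 * q + 2"
  by (simp add: pq_params_def)

text \<open>An isomorphism multiplies all three exponents by one number w modulo q. If i = 1, then w
  = 1 and nothing can change; if i = 0, it only matters whether j is 0 or 1. As w is not known to be
  a unit, both directions are used: a zero exponent on either side forces a zero on the
  other.\<close>

lemma param_brace_noniso:
  assumes p: "prime p" and q: "prime q" and qp: "q < p" and g: "ord p g = q"
    and x: "x \<in> set (pq_params q)" and y: "y \<in> set (pq_params q)"
    and iso: "param_brace p q (int g) x \<cong>\<^sub>b param_brace p q (int g) y"
    and iso': "param_brace p q (int g) y \<cong>\<^sub>b param_brace p q (int g) x"
  shows "x = y"
proof -
  have q1: "q > 1" using q prime_gt_1_nat by blast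
  have cop: "coprime p g"
    using g q1 ord_eq_0[of p g] by auto
  obtain i l j where x_eq: "x = (i, l, j)" by (cases x)
  obtain i' l' j' where y_eq: "y = (i', l', j')" by (cases y)
  have exps: "\<exists>w. [c' * w = c] (mod q) \<and> [d' * w = d] (mod q) \<and> [e' * w = e] (mod q)"
    if iso: "param_brace p q (int g) (c, d, e) \<cong>\<^sub>b param_brace p q (int g) (c', d', e')"
    for c d e c' d' e'
  proof -
    obtain w where w: "[(int g ^ c') ^ w = int g ^ c] (mod int p)"
      "[(int g ^ d') ^ w = int g ^ d] (mod int p)" "[(int g ^ e') ^ w = int g ^ e] (mod int p)"
      using model_brace_iso_imp_powers[OF p q qp iso[unfolded param_brace_def split_conv]] .
    have "[b' * w = b] (mod q)" if "[(int g ^ b') ^ w = int g ^ b] (mod int p)" for b b'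
    proof -
      have "[int (g ^ (b' * w)) = int (g ^ b)] (mod int p)"
        using that by (simp add: power_mult)
      then show ?thesis
        unfolding cong_int_iff using order_divides_expdiff[OF cop] g by simp
    qed
    with w show ?thesis by blast
  qed
  obtain w where w: "[i' * w = i] (mod q)" "[l' * w = l] (mod q)" "[j' * w = j] (mod q)"
    using exps[OF iso[unfolded x_eq y_eq]] by blast
  obtain z where z: "[i * z = i'] (mod q)" "[l * z = l'] (mod q)" "[j * z = j'] (mod q)"
    using exps[OF iso'[unfolded x_eq y_eq]] by blast
  have "i \<le> 1" "i' \<le> 1" "l \<le> 1" "l' \<le> 1"
    using x y by (auto simp: set_pq_params[OF q1] x_eq y_eq)
  then have il: "i = i'" "l = l'"
    using w(1,2) z(1,2) q1 by (auto simp: le_Suc_eq cong_def)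
  have "j = j'"
  proof (cases "i = 0")
    case True
    then have "j \<le> 1" "j' \<le> 1"
      using x y il by (auto simp: set_pq_params[OF q1] x_eq y_eq)
    then show ?thesis
      using w(3) z(3) q1 by (auto simp: le_Suc_eq cong_def)
  next
    case False
    then have "i = 1"
      using \<open>i \<le> 1\<close> by simp
    then have "[w = 1] (mod q)"
      using w(1) il by simp
    then have "[j' * w = j' * 1] (mod q)"
      by (intro cong_mult cong_refl)
    then have "[j = j'] (mod q)"
      using w(3) by (metis cong_sym cong_trans mult.right_neutral)
    moreover have "1 \<le> j" "j \<le> q" "1 \<le> j'" "j' \<le> q"
      using x y \<open>i = 1\<close> il by (auto simp: set_pq_params[OF q1] x_eq y_eq)
    ultimately show ?thesis
      unfolding cong_def by (cases "j = q"; cases "j' = q") (auto simp: le_less)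
  qed
  then show ?thesis
    using il by (simp add: x_eq y_eq)
qed

text \<open>The first nontrivial root among h and k is a power of g with exponent invertible modulo
  q. Raising all parameters to the inverse exponent turns this root into g itself.\<close>

lemma model_brace_in_params:
  assumes p: "prime p" and q: "prime q" and g: "ord p g = q"
    and h: "[h ^ q = 1] (mod int p)" and k: "[k ^ q = 1] (mod int p)" and a: "a = 1 \<or> a = h"
  shows "\<exists>x \<in> set (pq_params q). param_brace p q (int g) x \<cong>\<^sub>b model_brace p q h a k"
proof -
  have q1: "q > 1" and p0: "p > 0" using p q prime_gt_1_nat prime_gt_0_nat by blast+
  have a': "[a ^ q = 1] (mod int p)" using a h by auto
  have rescale: "\<exists>s. coprime s q \<and> [c ^ s = int g] (mod int p)"
    if c: "[c ^ q = 1] (mod int p)" "\<not> [c = 1] (mod int p)" for c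
  proof -
    obtain r where r: "r < q" "[c = int g ^ r] (mod int p)"
      using unity_root_is_power[OF p q1 g c(1)] .
    then have "r > 0" using c(2) by (cases r) auto
    then have "coprime q r"
      using prime_imp_coprime[OF q] nat_dvd_not_less r(1) by blast
    then have "coprime r q"
      by (rule coprime_commute[THEN iffD1])
    then obtain s where s: "[r * s = 1] (mod q)"
      using cong_solve_coprime_nat[of r q] by auto
    then have "coprime s q"
      using cong_imp_coprime[OF cong_sym[OF s]] by simp
    have "[g ^ (r * s) = g ^ 1] (mod p)"
      using s g q1 ord_eq_0[of p g] by (subst order_divides_expdiff) auto
    then have "[int (g ^ (r * s)) = int (g ^ 1)] (mod int p)"
      by (simp only: cong_int_iff)
    then have "[(int g ^ r) ^ s = int g] (mod int p)"
      by (simp add: power_mult)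
    moreover have "[c ^ s = (int g ^ r) ^ s] (mod int p)"
      by (intro cong_pow r)
    ultimately show ?thesis
      using \<open>coprime s q\<close> cong_trans by blast
  qed
  consider (one) "[h = 1] (mod int p)" "[k = 1] (mod int p)"
    | (circ) "[h = 1] (mod int p)" "\<not> [k = 1] (mod int p)" | (add) "\<not> [h = 1] (mod int p)"
    by blast
  then show ?thesis
  proof cases
    case one
    have "model_brace p q (h ^ 1) (a ^ 1) (k ^ 1) = param_brace p q (int g) (0, 0, 0)"
      using one a unfolding param_brace_def by (auto intro!: model_brace_cong)
    then show ?thesis
      using model_brace_rescale[of p q 1 h a k] p0 q1 h a' k set_pq_params[OF q1]
      by (intro bexI[of _ "(0, 0, 0)"]) auto
  next
    case circ
    then obtain s where s: "coprime s q" "[k ^ s = int g] (mod int p)"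
      using rescale[OF k] by blast
    have "[h ^ s = 1] (mod int p)"
      using cong_pow[OF circ(1), of s] by simp
    then have "model_brace p q (h ^ s) (a ^ s) (k ^ s) = param_brace p q (int g) (0, 0, 1)"
      using s a unfolding param_brace_def by (auto intro!: model_brace_cong)
    then show ?thesis
      using model_brace_rescale[of p q s h a k] p0 q1 h a' k set_pq_params[OF q1] s
      by (intro bexI[of _ "(0, 0, 1)"]) auto
  next
    case add
    then obtain s where s: "coprime s q" "[h ^ s = int g] (mod int p)"
      using rescale[OF h] by blast
    have "[(k ^ s) ^ q = 1] (mod int p)"
      using cong_pow[OF k, of s] by (simp add: mult.commute flip: power_mult)
    then obtain r where r: "r < q" "[k ^ s = int g ^ r] (mod int p)"
      using unity_root_is_power[OF p q1 g] by blast
    \<comment> \<open>The list runs through the exponents 1, ..., q, so the class of 0 is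
      represented by q.\<close>
    define j where "j = (if r = 0 then q else r)"
    have "[int (g ^ q) = int 1] (mod int p)"
      unfolding cong_int_iff using ord[of g p] g by simp
    then have kj: "[k ^ s = int g ^ j] (mod int p)"
      using r(2) by (auto simp: j_def cong_def)
    have j: "1 \<le> j" "j \<le> q" using r q1 by (auto simp: j_def)
    obtain l where l: "l \<le> 1" "[a ^ s = int g ^ l] (mod int p)"
      using a s(2) by (metis cong_refl le_numeral_extra(4) power_0 power_one power_one_right zero_le)
    have "model_brace p q (h ^ s) (a ^ s) (k ^ s) = param_brace p q (int g) (1, l, j)"
      using s l kj unfolding param_brace_def by (auto intro!: model_brace_cong)
    then show ?thesis
      using model_brace_rescale[of p q s h a k] p0 q1 h a' k set_pq_params[OF q1] s j l(1)
      by (intro bexI[of _ "(1, l, j)"]) auto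
  qed
qed

section \<open>Groups of order \<open>p q\<close>\<close>

lemma (in group) pow_eq_iff_cong:
  assumes "x \<in> carrier G"
  shows "x [^] (i::nat) = x [^] (j::nat) \<longleftrightarrow> [i = j] (mod ord x)"
  using int_pow_eq[OF assms, of "int i" "int j"]
  by (simp add: int_pow_int cong_iff_dvd_diff flip: cong_int_iff) (metis dvd_diff_commute)

lemma (in group) ord_prime:
  assumes "x \<in> carrier G" "x \<noteq> \<one>" "x [^] n = \<one>" "prime n"
  shows "ord x = n"
  using assms pow_eq_id[of x n] ord_eq_1[of x] by (auto simp: prime_nat_iff)

lemma (in group) subgroup_coprime_pow:
  assumes "subgroup H G" "x \<in> carrier G" "x [^] (n::nat) \<in> H" "x [^] (d::nat) \<in> H" "coprime d n"
  shows "x \<in> H"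
proof -
  obtain u v :: int where uv: "u * int d + v * int n = 1"
    using bezout_int[of "int d" "int n"] assms(5) by auto
  have "(x [^] int d) [^] u \<otimes> (x [^] int n) [^] v \<in> H"
    using assms subgroup.m_closed subgroup_int_pow_closed by (metis int_pow_int)
  moreover have "(x [^] int d) [^] u \<otimes> (x [^] int n) [^] v = x [^] (u * int d + v * int n)"
    using assms(2) by (simp add: int_pow_pow int_pow_mult mult.commute)
  ultimately show ?thesis
    using assms(2) uv by (simp add: int_pow_1)
qed

text \<open>Otherwise x^(j-i) and x^n would both lie in \<open>H\<close> with coprime exponents, and
  so would x. The claim is about cosets of an arbitrary subgroup because it serves to prove that the
  subgroup of order p is unique, before normality is known.\<close>

lemma (in group) coset_powers_eq:
  assumes H: "subgroup H G" and x: "x \<in> carrier G" "x \<notin> H" "x [^] (n::nat) \<in> H" and n: "prime n"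
    and eq: "h \<otimes> x [^] (i::nat) = h' \<otimes> x [^] (j::nat)" and h: "h \<in> H" "h' \<in> H"
  shows "[i = j] (mod n)"
proof -
  have main: "[i = j] (mod n)" if "i \<le> j" "h \<otimes> x [^] i = h' \<otimes> x [^] j" "h \<in> H" "h' \<in> H" for h h' i j
  proof (rule ccontr)
    assume "\<not> [i = j] (mod n)"
    then have "\<not> n dvd j - i"
      using that(1) cong_altdef_nat[of i j n] by (auto dest: cong_sym)
    then have cop: "coprime (j - i) n"
      using prime_imp_coprime[OF n] coprime_commute[THEN iffD1] by blast
    have hc: "h \<in> carrier G" "h' \<in> carrier G"
      using that(3,4) subgroup.mem_carrier[OF H] by blast+
    have "h \<otimes> x [^] i = (h' \<otimes> x [^] (j - i)) \<otimes> x [^] i"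
      using that(1,2) hc x by (simp add: m_assoc nat_pow_mult)
    then have "h = h' \<otimes> x [^] (j - i)"
      using hc x by simp
    then have "x [^] (j - i) = inv h' \<otimes> h"
      using hc x by (simp add: m_assoc[symmetric])
    then have "x [^] (j - i) \<in> H"
      using that H by (simp add: subgroup.m_closed subgroup.m_inv_closed)
    then show False
      using subgroup_coprime_pow[OF H x(1) x(3) _ cop] x(2) by blast
  qed
  show ?thesis
    using main[OF _ eq h] cong_sym[OF main[OF _ eq[symmetric] h(2,1)]] nat_le_linear[of i j] by blast
qed

lemma (in group) inj_on_coset_powers:
  assumes H: "subgroup H G" and x: "x \<in> carrier G" "x \<notin> H" "x [^] (n::nat) \<in> H" and n: "prime n"
  shows "inj_on (\<lambda>(h, i). h \<otimes> x [^] i) (H \<times> {..<n})"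
proof (rule inj_onI)
  fix a b
  assume ab: "a \<in> H \<times> {..<n}" "b \<in> H \<times> {..<n}"
    "(\<lambda>(h, i). h \<otimes> x [^] i) a = (\<lambda>(h, i). h \<otimes> x [^] i) b"
  obtain h i h' j where eqs: "a = (h, i)" "b = (h', j)" by fastforce
  have "i = j"
    using coset_powers_eq[OF assms, of h i h' j] ab by (simp add: eqs cong_def)
  then show "a = b"
    using ab x subgroup.mem_carrier[OF H] by (simp add: eqs)
qed

text \<open>The order of v modulo q divides q - 1, hence is smaller than both primes and coprime to
  them. It also divides p q, so it is 1.\<close>

lemma pow_cong_1_imp_cong_1:
  fixes v :: nat
  assumes p: "prime p" and q: "prime q" and "q < p" and v: "[v ^ (p * q) = 1] (mod q)"
  shows "[v = 1] (mod q)"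
proof -
  have "coprime q v"
  proof (rule ccontr)
    assume "\<not> coprime q v"
    then have "q dvd v"
      using q prime_imp_coprime by blast
    moreover have "p * q > 0"
      using p q by (simp add: prime_gt_0_nat)
    ultimately have "q dvd v ^ (p * q)"
      by (meson dvd_power dvd_trans dvd_power_same)
    then have "[1 = 0] (mod q)"
      using v by (metis cong_0_iff cong_sym cong_trans)
    then show False
      using q by (simp add: cong_0_iff)
  qed
  define d where "d = ord q v"
  have d0: "d > 0"
    using \<open>coprime q v\<close> ord_eq_0[of q v] by (simp add: d_def)
  have "d dvd q - 1"
    using order_divides_totient[OF \<open>coprime q v\<close>] q by (simp add: d_def totient_prime)
  moreover have "q - 1 > 0"
    using q prime_gt_1_nat by simp
  ultimately have "d < q"
    using dvd_imp_le[of d "q - 1"] by linarith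
  then have "coprime q d" "coprime p d"
    using prime_imp_coprime[OF q] prime_imp_coprime[OF p] d0 \<open>q < p\<close> nat_dvd_not_less[of d]
    by (meson less_trans)+
  moreover have "d dvd p * q"
    using v ord_divides[of v "p * q" q] by (simp add: d_def)
  ultimately have "d = 1"
    using coprime_dvd_mult_left_iff[of d q p] coprime_absorb_left[of d p] by (simp add: coprime_commute)
  then show ?thesis
    using ord[of v q] by (simp add: d_def)
qed

locale pq_group = group +
  fixes p q :: nat
  assumes p: "prime p" and q: "prime q" and qp: "q < p" and order_pq: "order G = p * q"
begin

lemma pq_gt [simp]: "p > 1" "q > 1" "p > 0" "q > 0"
  using p q prime_gt_1_nat prime_gt_0_nat by blast+

lemma fin: "finite (carrier G)"
  using order_pq pq_gt order_gt_0_iff_finite by (metis mult_pos_pos)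

text \<open>Given by an equation instead of a chosen Sylow subgroup: stability under automorphisms
  is then immediate, and additive and circle versions can be compared.\<close>

definition P where "P = {x \<in> carrier G. x [^] p = \<one>}"

lemma P_carrier: "x \<in> P \<Longrightarrow> x \<in> carrier G"
  by (simp add: P_def)

text \<open>A solution x of x^p = 1 outside \<open>H\<close> would yield p * p distinct products h
  x^i in a group of only p * q elements.\<close>

lemma subgroup_card_p_eq_P:
  assumes H: "subgroup H G" and card: "card H = p"
  shows "H = P"
proof
  show "H \<subseteq> P"
  proof
    fix x assume x: "x \<in> H"
    interpret H: group "G\<lparr>carrier := H\<rparr>"
      using H by (rule subgroup.subgroup_is_group) (rule is_group)
    have "x [^]\<^bsub>G\<lparr>carrier := H\<rparr>\<^esub> card H = \<one>"
      using H.pow_order_eq_1[of x] x by (simp add: order_def)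
    then show "x \<in> P"
      using x card subgroup.mem_carrier[OF H] by (simp add: P_def flip: nat_pow_consistent)
  qed
  show "P \<subseteq> H"
  proof (rule subsetI, rule ccontr)
    fix x assume x: "x \<in> P" "x \<notin> H"
    then have "inj_on (\<lambda>(h, i). h \<otimes> x [^] i) (H \<times> {..<p})"
      using inj_on_coset_powers[OF H _ _ _ p, of x] subgroup.one_closed[OF H] by (simp add: P_def)
    moreover have "(\<lambda>(h, i). h \<otimes> x [^] i) ` (H \<times> {..<p}) \<subseteq> carrier G"
      using x subgroup.mem_carrier[OF H] by (auto simp: P_def)
    ultimately have "card (H \<times> {..<p}) \<le> card (carrier G)"
      using fin card_inj_on_le by blast
    then have "p * p \<le> p * q"
      using order_pq card by (simp add: order_def card_cartesian_product)
    then show False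
      using qp by simp
  qed
qed

lemma subgroup_P: "subgroup P G" and card_P: "card P = p"
proof -
  obtain H where "subgroup H G" "card H = p"
    using sylow_thm[OF p is_group, of 1 q] order_pq fin by auto
  moreover from this have "H = P"
    by (rule subgroup_card_p_eq_P)
  ultimately show "subgroup P G" "card P = p"
    by simp_all
qed

lemma P_closed: "x \<in> P \<Longrightarrow> y \<in> P \<Longrightarrow> x \<otimes> y \<in> P" "x \<in> P \<Longrightarrow> x [^] (n::nat) \<in> P" "\<one> \<in> P"
proof -
  show "x \<in> P \<Longrightarrow> y \<in> P \<Longrightarrow> x \<otimes> y \<in> P" for x y
    using subgroup.m_closed[OF subgroup_P] .
  show "\<one> \<in> P"
    using subgroup.one_closed[OF subgroup_P] .
  show "x \<in> P \<Longrightarrow> x [^] (n::nat) \<in> P"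
    by (induction n) (simp_all add: \<open>\<one> \<in> P\<close> subgroup.m_closed[OF subgroup_P])
qed

lemma conj_P:
  assumes "x \<in> P" "c \<in> carrier G"
  obtains y where "y \<in> P" "c \<otimes> x = y \<otimes> c"
proof -
  have x: "x \<in> carrier G" "x [^] p = \<one>"
    using assms by (simp_all add: P_def)
  have "(c \<otimes> x \<otimes> inv c) [^] n = c \<otimes> x [^] n \<otimes> inv c" for n :: nat
  proof (induction n)
    case (Suc n)
    have "(c \<otimes> x [^] n \<otimes> inv c) \<otimes> (c \<otimes> x \<otimes> inv c)
        = c \<otimes> x [^] n \<otimes> (x \<otimes> inv c)"
      using x assms(2) by (simp add: m_assoc inv_solve_left')
    then show ?case
      using Suc x assms(2) by (simp add: m_assoc)
  qed (use assms(2) in simp)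
  then have "c \<otimes> x \<otimes> inv c \<in> P"
    using x assms(2) by (simp add: P_def)
  moreover have "c \<otimes> x = (c \<otimes> x \<otimes> inv c) \<otimes> c"
    using x assms(2) by (simp add: m_assoc)
  ultimately show thesis
    using that by blast
qed

lemma pow_q_in_P: "x \<in> carrier G \<Longrightarrow> x [^] q \<in> P"
  using pow_order_eq_1[of x] by (simp add: P_def order_pq nat_pow_pow mult.commute)

lemma mult_pow_in_coset:
  assumes "x \<in> P" "c \<in> carrier G"
  shows "\<exists>y\<in>P. (x \<otimes> c) [^] (n::nat) = y \<otimes> c [^] n"
proof (induction n)
  case 0
  show ?case
    by (intro bexI[of _ \<one>]) (simp_all add: P_closed)
next
  case (Suc n)
  then obtain y where y: "y \<in> P" "(x \<otimes> c) [^] n = y \<otimes> c [^] n" by blast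
  obtain z where z: "z \<in> P" "c [^] n \<otimes> x = z \<otimes> c [^] n"
    using conj_P[OF assms(1), of "c [^] n"] assms(2) by auto
  have "(x \<otimes> c) [^] Suc n = y \<otimes> (c [^] n \<otimes> x) \<otimes> c"
    using y assms by (simp add: m_assoc P_carrier)
  also have "\<dots> = (y \<otimes> z) \<otimes> c [^] Suc n"
    unfolding z(2) using y z(1) assms by (simp add: m_assoc P_carrier)
  finally show ?case
    using P_closed(1)[OF y(1) z(1)] by blast
qed

lemma coset_cover:
  assumes b: "b \<in> carrier G" "b \<notin> P" and x: "x \<in> carrier G"
  obtains y i where "y \<in> P" "x = y \<otimes> b [^] (i::nat)"
proof -
  have "inj_on (\<lambda>(h, i). h \<otimes> b [^] i) (P \<times> {..<q})"
    using inj_on_coset_powers[OF subgroup_P b pow_q_in_P q] b by blast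
  then have "card ((\<lambda>(h, i). h \<otimes> b [^] i) ` (P \<times> {..<q})) = card (carrier G)"
    using order_pq card_P by (simp add: card_image order_def card_cartesian_product)
  then have "(\<lambda>(h, i). h \<otimes> b [^] i) ` (P \<times> {..<q}) = carrier G"
    using fin b by (intro card_subset_eq) (auto simp: P_carrier)
  then have "x \<in> (\<lambda>(h, i). h \<otimes> b [^] i) ` (P \<times> {..<q})"
    using x by simp
  then show thesis
    by (auto intro: that)
qed

lemma generator_P:
  assumes \<sigma>: "\<sigma> \<in> P" "\<sigma> \<noteq> \<one>"
  shows "\<sigma> [^] (i::nat) = \<sigma> [^] (j::nat) \<longleftrightarrow> [i = j] (mod p)"
    and "x \<in> P \<Longrightarrow> \<exists>i::nat. x = \<sigma> [^] i"
proof -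
  have ord: "ord \<sigma> = p"
    using \<sigma> ord_prime[OF _ _ _ p] by (simp add: P_def)
  show eq: "\<sigma> [^] (i::nat) = \<sigma> [^] (j::nat) \<longleftrightarrow> [i = j] (mod p)" for i j
    using pow_eq_iff_cong[of \<sigma> i j] \<sigma> ord by (simp add: P_carrier)
  have "inj_on (\<lambda>i. \<sigma> [^] i) {..<p}"
    using eq by (auto simp: inj_on_def cong_def)
  then have "card ((\<lambda>i. \<sigma> [^] i) ` {..<p}) = card P"
    by (simp add: card_image card_P)
  then have "(\<lambda>i. \<sigma> [^] i) ` {..<p} = P"
    using fin \<sigma> P_closed(2) finite_subset[of P "carrier G"] P_carrier
    by (intro card_subset_eq) auto
  then show "x \<in> P \<Longrightarrow> \<exists>i::nat. x = \<sigma> [^] i"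
    by auto
qed

lemma exists_order_q: obtains \<tau> where "\<tau> \<in> carrier G" "\<tau> \<noteq> \<one>" "\<tau> [^] q = \<one>"
proof -
  obtain H where H: "subgroup H G" "card H = q"
    using sylow_thm[OF q is_group, of 1 p] order_pq fin by (auto simp: mult.commute)
  have "\<not> H \<subseteq> {\<one>}"
    using H(2) pq_gt(2) card_mono[of "{\<one>}" H] by auto
  then obtain x where x: "x \<in> H" "x \<noteq> \<one>" by blast
  interpret H: group "G\<lparr>carrier := H\<rparr>"
    using H(1) by (rule subgroup.subgroup_is_group) (rule is_group)
  have "x [^]\<^bsub>G\<lparr>carrier := H\<rparr>\<^esub> card H = \<one>"
    using H.pow_order_eq_1[of x] x by (simp add: order_def)
  then show thesis
    using that[of x] x H(2) subgroup.mem_carrier[OF H(1)] by (simp flip: nat_pow_consistent)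
qed

lemma order_q_notin_P:
  assumes "\<tau> \<in> carrier G" "\<tau> \<noteq> \<one>" "\<tau> [^] q = \<one>"
  shows "\<tau> \<notin> P"
  using assms ord_prime[of \<tau> p] ord_prime[of \<tau> q] p q qp by (auto simp: P_def)

lemma pow_conj:
  assumes c: "\<sigma> \<in> carrier G" "\<tau> \<in> carrier G" and h: "\<tau> \<otimes> \<sigma> = \<sigma> [^] (h::nat) \<otimes> \<tau>"
  shows "\<tau> [^] m \<otimes> \<sigma> [^] s = \<sigma> [^] (h ^ m * s) \<otimes> \<tau> [^] (m::nat)"
proof (induction m arbitrary: s)
  case (Suc m)
  have one: "\<tau> \<otimes> \<sigma> [^] s = \<sigma> [^] (h * s) \<otimes> \<tau>" for s
  proof (induction s)
    case (Suc s)
    have "\<tau> \<otimes> \<sigma> [^] Suc s = (\<tau> \<otimes> \<sigma> [^] s) \<otimes> \<sigma>"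
      using c by (simp add: m_assoc)
    also have "\<dots> = \<sigma> [^] (h * s) \<otimes> (\<tau> \<otimes> \<sigma>)"
      unfolding Suc using c by (simp add: m_assoc)
    also have "\<dots> = \<sigma> [^] (h * Suc s) \<otimes> \<tau>"
      unfolding h using c by (simp add: nat_pow_mult add.commute flip: m_assoc)
    finally show ?case .
  qed (use c in simp)
  have "\<tau> [^] Suc m \<otimes> \<sigma> [^] s = \<tau> [^] m \<otimes> (\<tau> \<otimes> \<sigma> [^] s)"
    using c by (simp add: m_assoc)
  also have "\<dots> = (\<tau> [^] m \<otimes> \<sigma> [^] (h * s)) \<otimes> \<tau>"
    unfolding one using c by (simp add: m_assoc)
  also have "\<dots> = \<sigma> [^] (h ^ Suc m * s) \<otimes> \<tau> [^] Suc m"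
    unfolding Suc using c by (simp add: m_assoc ac_simps)
  finally show ?case .
qed (use c in simp)

section \<open>Coordinates on a group of order p q\<close>

definition coord :: "'a \<Rightarrow> 'a \<Rightarrow> int \<times> int \<Rightarrow> 'a" where
  "coord \<sigma> \<tau> = (\<lambda>(n, m). \<sigma> [^] nat n \<otimes> \<tau> [^] nat m)"

text \<open>Every element has a unique normal form \<sigma>^n \<tau>^m, and moving \<tau>^m past
  \<sigma>^s multiplies the exponent s by h^m. Since \<tau>^q = 1 commutes with \<sigma>, the
  exponent satisfies h^q = 1 modulo p.\<close>

lemma
  assumes \<sigma>: "\<sigma> \<in> P" "\<sigma> \<noteq> \<one>" and \<tau>: "\<tau> \<in> carrier G" "\<tau> \<noteq> \<one>" "\<tau> [^] q = \<one>"
    and h: "\<tau> \<otimes> \<sigma> = \<sigma> [^] (h::nat) \<otimes> \<tau>"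
  shows conj_exponent_unity: "[int h ^ q = 1] (mod int p)"
    and coord_bij: "bij_betw (coord \<sigma> \<tau>) ({0..<int p} \<times> {0..<int q}) (carrier G)"
    and coord_mult: "\<lbrakk>x \<in> {0..<int p} \<times> {0..<int q}; y \<in> {0..<int p} \<times> {0..<int q}\<rbrakk> \<Longrightarrow>
      coord \<sigma> \<tau> (twisted_op p q 1 (int h) x y) = coord \<sigma> \<tau> x \<otimes> coord \<sigma> \<tau> y"
proof -
  note \<sigma>c = P_carrier[OF \<sigma>(1)]
  note conj = pow_conj[OF \<sigma>c \<tau>(1) h]
  have "\<sigma> [^] (1::nat) = \<sigma> [^] (h ^ q)"
    using conj[of q 1] \<sigma>c \<tau> by simp
  then have "[int (h ^ q) = int 1] (mod int p)"
    unfolding cong_int_iff generator_P(1)[OF \<sigma>] by (rule cong_sym)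
  then show "[int h ^ q = 1] (mod int p)"
    by simp
  have \<tau>_notin: "\<tau> \<notin> P"
    using order_q_notin_P[OF \<tau>] .
  show "bij_betw (coord \<sigma> \<tau>) ({0..<int p} \<times> {0..<int q}) (carrier G)"
    unfolding bij_betw_def
  proof
    show inj: "inj_on (coord \<sigma> \<tau>) ({0..<int p} \<times> {0..<int q})"
    proof (rule inj_onI)
      fix a b
      assume ab: "a \<in> {0..<int p} \<times> {0..<int q}" "b \<in> {0..<int p} \<times> {0..<int q}"
        "coord \<sigma> \<tau> a = coord \<sigma> \<tau> b"
      obtain n m s t where eqs: "a = (n, m)" "b = (s, t)" by fastforce
      have *: "n \<in> {0..<int p}" "m \<in> {0..<int q}" "s \<in> {0..<int p}" "t \<in> {0..<int q}"
        "coord \<sigma> \<tau> (n, m) = coord \<sigma> \<tau> (s, t)"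
        using ab by (auto simp: eqs)
      then have eq: "\<sigma> [^] nat n \<otimes> \<tau> [^] nat m = \<sigma> [^] nat s \<otimes> \<tau> [^] nat t"
        by (simp add: coord_def)
      then have "[nat m = nat t] (mod q)"
        using coset_powers_eq[OF subgroup_P \<tau>(1) \<tau>_notin pow_q_in_P[OF \<tau>(1)] q] P_closed(2)[OF \<sigma>(1)]
        by blast
      then have "nat m = nat t"
        using * by (auto simp: cong_def nat_less_iff)
      moreover from this have "[nat n = nat s] (mod p)"
        using eq \<sigma>c \<tau>(1) by (simp flip: generator_P(1)[OF \<sigma>])
      then have "nat n = nat s"
        using * by (auto simp: cong_def nat_less_iff)
      ultimately show "a = b"
        using * by (simp add: eqs eq_nat_nat_iff)
    qed
    show "coord \<sigma> \<tau> ` ({0..<int p} \<times> {0..<int q}) = carrier G"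
    proof (rule card_subset_eq[OF fin])
      show "coord \<sigma> \<tau> ` ({0..<int p} \<times> {0..<int q}) \<subseteq> carrier G"
        using \<sigma>c \<tau>(1) by (auto simp: coord_def)
      show "card (coord \<sigma> \<tau> ` ({0..<int p} \<times> {0..<int q})) = card (carrier G)"
        using card_image[OF inj] order_pq by (simp add: order_def card_cartesian_product)
    qed
  qed
  assume xy: "x \<in> {0..<int p} \<times> {0..<int q}" "y \<in> {0..<int p} \<times> {0..<int q}"
  obtain n m s t where nm: "x = (int n, int m)" "y = (int s, int t)"
  proof
    show "x = (int (nat (fst x)), int (nat (snd x)))" "y = (int (nat (fst y)), int (nat (snd y)))"
      using xy by auto
  qed
  have "\<tau> [^] ((m + t) mod q) = \<tau> [^] (m + t)"
  proof -
    have "\<tau> [^] (m + t) = (\<tau> [^] q) [^] ((m + t) div q) \<otimes> \<tau> [^] ((m + t) mod q)"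
      using \<tau>(1) by (simp add: nat_pow_pow nat_pow_mult)
    then show ?thesis
      using \<tau> by simp
  qed
  moreover have "\<sigma> [^] ((n + h ^ m * s) mod p) = \<sigma> [^] (n + h ^ m * s)"
    by (simp add: generator_P(1)[OF \<sigma>] cong_def)
  moreover have "coord \<sigma> \<tau> (twisted_op p q 1 (int h) x y)
      = \<sigma> [^] ((n + h ^ m * s) mod p) \<otimes> \<tau> [^] ((m + t) mod q)"
    by (simp add: nm twisted_op_simp coord_def flip: of_nat_power of_nat_mult of_nat_add zmod_int)
  moreover have "coord \<sigma> \<tau> x \<otimes> coord \<sigma> \<tau> y = \<sigma> [^] n \<otimes> (\<tau> [^] m \<otimes> \<sigma> [^] s) \<otimes> \<tau> [^] t"
    using \<sigma>c \<tau>(1) by (simp add: nm coord_def m_assoc)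
  ultimately show "coord \<sigma> \<tau> (twisted_op p q 1 (int h) x y) = coord \<sigma> \<tau> x \<otimes> coord \<sigma> \<tau> y"
    unfolding conj using \<sigma>c \<tau>(1) by (simp add: m_assoc flip: nat_pow_mult)
qed

end

section \<open>Skew braces of order \<open>p q\<close>\<close>

text \<open>Two separate group records replace the ring record, so that the theory of
  \<open>pq_group\<close> applies to each operation and the additive group can be exchanged for its
  opposite while \<open>C\<close> stays.\<close>

locale pq_brace = pq_group G p q + C: group C
  for G :: "('a, 'b) monoid_scheme" (structure) and C :: "('a, 'c) monoid_scheme" and p q +
  assumes carrier_C: "carrier C = carrier G"
    and law: "\<lbrakk>a \<in> carrier G; b \<in> carrier G; c \<in> carrier G\<rbrakk> \<Longrightarrow>
      a \<otimes>\<^bsub>C\<^esub> (b \<otimes> c) = (a \<otimes>\<^bsub>C\<^esub> b) \<otimes> inv a \<otimes> (a \<otimes>\<^bsub>C\<^esub> c)"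
begin

sublocale C: pq_group C p q
  by unfold_locales (use p q qp order_pq in \<open>simp_all add: order_def carrier_C\<close>)

section \<open>The action of the circle group on the additive group\<close>

definition lam :: "'a \<Rightarrow> 'a \<Rightarrow> 'a" where
  "lam a b = inv a \<otimes> (a \<otimes>\<^bsub>C\<^esub> b)"

lemma C_closed [simp]: "\<lbrakk>a \<in> carrier G; b \<in> carrier G\<rbrakk> \<Longrightarrow> a \<otimes>\<^bsub>C\<^esub> b \<in> carrier G"
  using C.m_closed[of a b] by (simp add: carrier_C)

lemma C_pow_closed [simp]: "a \<in> carrier G \<Longrightarrow> a [^]\<^bsub>C\<^esub> (n::nat) \<in> carrier G"
  using C.nat_pow_closed[of a n] by (simp add: carrier_C)

lemma lam_closed [simp]: "\<lbrakk>a \<in> carrier G; b \<in> carrier G\<rbrakk> \<Longrightarrow> lam a b \<in> carrier G"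
  by (simp add: lam_def)

lemma circ_eq: "\<lbrakk>a \<in> carrier G; b \<in> carrier G\<rbrakk> \<Longrightarrow> a \<otimes>\<^bsub>C\<^esub> b = a \<otimes> lam a b"
  by (simp add: lam_def flip: m_assoc)

lemma one_C: "\<one>\<^bsub>C\<^esub> = \<one>"
proof -
  have c: "\<one>\<^bsub>C\<^esub> \<in> carrier G"
    using C.one_closed by (simp add: carrier_C)
  have "\<one>\<^bsub>C\<^esub> \<otimes>\<^bsub>C\<^esub> (\<one> \<otimes> \<one>) = (\<one>\<^bsub>C\<^esub> \<otimes>\<^bsub>C\<^esub> \<one>) \<otimes> inv \<one>\<^bsub>C\<^esub> \<otimes> (\<one>\<^bsub>C\<^esub> \<otimes>\<^bsub>C\<^esub> \<one>)"
    by (rule law[OF c]) simp_all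
  then have "\<one> = inv \<one>\<^bsub>C\<^esub>"
    using c by (simp add: carrier_C)
  then show ?thesis
    using c by (metis inv_inv inv_one)
qed

lemma lam_mult:
  "\<lbrakk>a \<in> carrier G; b \<in> carrier G; c \<in> carrier G\<rbrakk> \<Longrightarrow> lam a (b \<otimes> c) = lam a b \<otimes> lam a c"
  by (simp add: lam_def law m_assoc)

lemma lam_one_right [simp]: "a \<in> carrier G \<Longrightarrow> lam a \<one> = \<one>"
  using C.r_one[of a, unfolded one_C carrier_C] by (simp add: lam_def)

lemma lam_one_left [simp]: "c \<in> carrier G \<Longrightarrow> lam \<one> c = c"
  using C.l_one[of c, unfolded one_C carrier_C] by (simp add: lam_def)

text \<open>With \<open>lam_mult\<close> and \<open>lam_inj\<close>, this makes \<open>lam\<close>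
  an action of the circle group by automorphisms of the finite additive group. Orders in
  \<open>C\<close> thereby bound the orders of these automorphisms.\<close>

lemma lam_circ:
  assumes "a \<in> carrier G" "b \<in> carrier G" "c \<in> carrier G"
  shows "lam (a \<otimes>\<^bsub>C\<^esub> b) c = lam a (lam b c)"
proof -
  have "(a \<otimes>\<^bsub>C\<^esub> b) \<otimes>\<^bsub>C\<^esub> c = a \<otimes>\<^bsub>C\<^esub> (b \<otimes> lam b c)"
    using C.m_assoc[of a b c] assms by (simp add: carrier_C circ_eq[of b c])
  also have "\<dots> = (a \<otimes>\<^bsub>C\<^esub> b) \<otimes> lam a (lam b c)"
    using assms by (simp add: law lam_def[of a "lam b c"] m_assoc)
  finally show ?thesis
    using assms by (simp add: lam_def[of "a \<otimes>\<^bsub>C\<^esub> b"] flip: m_assoc)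
qed

lemma lam_inj:
  assumes "a \<in> carrier G" "b \<in> carrier G" "c \<in> carrier G" "lam a b = lam a c"
  shows "b = c"
proof -
  have "a \<otimes>\<^bsub>C\<^esub> b = a \<otimes>\<^bsub>C\<^esub> c"
    using assms by (simp add: circ_eq)
  then show ?thesis
    using C.Units_l_cancel[of a b c] assms by (simp add: carrier_C)
qed

lemma lam_pow: "\<lbrakk>a \<in> carrier G; b \<in> carrier G\<rbrakk> \<Longrightarrow> lam a (b [^] (n::nat)) = lam a b [^] n"
  by (induction n) (simp_all add: lam_mult)

lemma lam_C_pow: "\<lbrakk>a \<in> carrier G; b \<in> carrier G\<rbrakk> \<Longrightarrow> lam (a [^]\<^bsub>C\<^esub> (n::nat)) b = (lam a ^^ n) b"
proof (induction n arbitrary: b)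
  case (Suc n)
  then show ?case
    by (simp add: lam_circ funpow_swap1)
qed (simp add: one_C)

lemma lam_pow_fix: "lam a b = b \<Longrightarrow> (lam a ^^ n) b = b"
  by (induction n) simp_all

text \<open>If \<open>lam a\<close> fixes a, it fixes every additive power of a, so circling with a
  amounts to adding a. This is the criterion by which one coordinate map comes to serve both
  groups.\<close>

lemma C_pow_eq:
  assumes a: "a \<in> carrier G" and fix_a: "lam a a = a"
  shows "a [^]\<^bsub>C\<^esub> (n::nat) = a [^] n"
proof (induction n)
  case (Suc n)
  have "a [^]\<^bsub>C\<^esub> Suc n = a \<otimes>\<^bsub>C\<^esub> a [^]\<^bsub>C\<^esub> n"
    using a by (metis C.nat_pow_Suc2 carrier_C)
  also have "\<dots> = a \<otimes> lam a (a [^] n)"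
    using a Suc by (simp add: circ_eq)
  also have "\<dots> = a [^] Suc n"
    using a nat_pow_Suc2[of a n] by (simp add: lam_pow fix_a)
  finally show ?case .
qed (simp add: one_C)

lemma lam_P: "\<lbrakk>a \<in> carrier G; x \<in> P\<rbrakk> \<Longrightarrow> lam a x \<in> P"
  using lam_pow[of a x p] by (simp add: P_def)

text \<open>\<open>P\<close> is stable under every \<open>lam a\<close>, hence closed under circle.
  An injective \<open>lam x\<close> is onto the finite set \<open>P\<close>, which provides the
  circle inverse of x inside \<open>P\<close>. Uniqueness of the subgroup of order p in
  \<open>C\<close> finishes the argument.\<close>

lemma C_P_eq: "C.P = P"
proof -
  have "subgroup P C"
  proof (rule C.subgroupI)
    fix x y assume xy: "x \<in> P" "y \<in> P"
    then show "x \<otimes>\<^bsub>C\<^esub> y \<in> P"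
      using P_closed(1) lam_P by (simp add: circ_eq P_carrier)
    have inj: "inj_on (lam x) P"
      using lam_inj xy(1) by (meson P_carrier inj_onI)
    have "lam x ` P = P"
      using lam_P[of x] P_carrier xy(1) inj finite_subset[of P "carrier G"] fin
      by (intro endo_inj_surj) auto
    moreover have "inv x \<in> P"
      using subgroup.m_inv_closed[OF subgroup_P xy(1)] .
    ultimately obtain z where z: "z \<in> P" "lam x z = inv x"
      by (metis imageE)
    then have "x \<otimes>\<^bsub>C\<^esub> z = \<one>\<^bsub>C\<^esub>"
      using xy(1) by (simp add: circ_eq P_carrier one_C)
    then have "inv\<^bsub>C\<^esub> x = z"
      using C.inv_equality[of z x] C.inv_comm[of x z] xy(1) z(1) P_carrier by (simp add: carrier_C)
    then show "inv\<^bsub>C\<^esub> x \<in> P"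
      using z(1) by simp
  qed (use P_carrier P_closed(3) in \<open>auto simp: carrier_C\<close>)
  then show ?thesis
    using C.subgroup_card_p_eq_P card_P by metis
qed

lemma lam_C_pow_P:
  assumes a: "a \<in> carrier G" and \<sigma>: "\<sigma> \<in> P" and u: "lam a \<sigma> = \<sigma> [^] (u::nat)"
  shows "lam (a [^]\<^bsub>C\<^esub> (n::nat)) \<sigma> = \<sigma> [^] (u ^ n)"
proof -
  have "(lam a ^^ n) \<sigma> = \<sigma> [^] (u ^ n)"
    by (induction n) (use a \<sigma> u in \<open>simp_all add: lam_pow nat_pow_pow P_carrier\<close>)
  then show ?thesis
    using a \<sigma> by (simp add: lam_C_pow P_carrier)
qed

text \<open>\<open>lam x\<close> raises y to a power u, and u^p = 1 modulo p because x has trivial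
  p-th circle power. Fermat gives u^p = u, so u = 1: an automorphism of Z_p whose order divides p is
  trivial.\<close>

lemma lam_P_P:
  assumes x: "x \<in> P" and y: "y \<in> P"
  shows "lam x y = y"
proof (cases "y = \<one>")
  case False
  note y' = y False
  note eq_iff = generator_P(1)[OF y']
  obtain u :: nat where u: "lam x y = y [^] u"
    using generator_P(2)[OF y'] lam_P[OF P_carrier[OF x] y] by blast
  have "x [^]\<^bsub>C\<^esub> p = \<one>"
    using x C_P_eq by (auto simp: C.P_def one_C)
  then have "y [^] (u ^ p) = y [^] (1::nat)"
    using lam_C_pow_P[OF P_carrier[OF x] y u, of p] y by (simp add: P_carrier)
  then have up: "[u ^ p = 1] (mod p)"
    unfolding eq_iff .
  have "\<not> p dvd u"
  proof
    assume "p dvd u"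
    then have "[u ^ p = 0] (mod p)"
      using pq_gt(3) by (meson cong_0_iff dvd_power dvd_trans dvd_power_same)
    then have "[1 = 0] (mod p)"
      using up cong_sym cong_trans by blast
    then show False
      using pq_gt(1) by (simp add: cong_def)
  qed
  then have "[u ^ (p - 1) * u = 1 * u] (mod p)"
    using fermat_theorem[OF p] by (intro cong_mult cong_refl)
  moreover have "u ^ (p - 1) * u = u ^ p"
    using pq_gt(3) by (cases p) (simp_all add: mult.commute)
  ultimately have "[u = 1] (mod p)"
    using up cong_sym cong_trans by (metis mult_1)
  then have "y [^] u = y [^] (1::nat)"
    unfolding eq_iff .
  then show ?thesis
    using u y by (simp add: P_carrier)
qed (use x P_carrier in simp)

lemma C_pow_P: "x \<in> P \<Longrightarrow> x [^]\<^bsub>C\<^esub> (n::nat) = x [^] n"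
  using C_pow_eq lam_P_P P_carrier by blast

text \<open>The automorphism of \<open>G / P\<close> induced by \<open>lam a\<close> has order dividing both \<open>p q\<close> and \<open>q - 1\<close>.\<close>

lemma lam_coset:
  assumes a: "a \<in> carrier G" and b: "b \<in> carrier G"
  obtains x where "x \<in> P" "lam a b = x \<otimes> b"
proof (cases "b \<in> P")
  case True
  have "lam a b \<otimes> inv b \<in> P"
    using lam_P[OF a True] True subgroup.m_inv_closed[OF subgroup_P] P_closed(1) by blast
  moreover have "lam a b = (lam a b \<otimes> inv b) \<otimes> b"
    using a b by (simp add: m_assoc)
  ultimately show thesis
    using that by blast
next
  case False
  obtain y v where y: "y \<in> P" "lam a b = y \<otimes> b [^] (v::nat)"
    using coset_cover[OF b False, of "lam a b"] a b by auto
  \<comment> \<open>Modulo \<open>P\<close>, applying \<open>lam a\<close> raises b to the power v,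
    so n applications raise it to v^n.\<close>
  have iter: "\<exists>x\<in>P. (lam a ^^ n) b = x \<otimes> b [^] (v ^ n)" for n
  proof (induction n)
    case 0
    show ?case
      using b by (intro bexI[of _ \<one>]) (simp_all add: P_closed)
  next
    case (Suc n)
    then obtain x where x: "x \<in> P" "(lam a ^^ n) b = x \<otimes> b [^] (v ^ n)" by blast
    obtain z where z: "z \<in> P" "(y \<otimes> b [^] v) [^] (v ^ n) = z \<otimes> (b [^] v) [^] (v ^ n)"
      using mult_pow_in_coset[OF y(1), of "b [^] v" "v ^ n"] b by auto
    have "(lam a ^^ Suc n) b = lam a x \<otimes> lam a b [^] (v ^ n)"
      using x a b by (simp add: lam_mult lam_pow P_carrier)
    also have "\<dots> = (lam a x \<otimes> z) \<otimes> b [^] (v ^ Suc n)"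
      using z x a b by (simp add: y(2) P_carrier m_assoc nat_pow_pow)
    finally show ?case
      using P_closed(1)[OF lam_P[OF a x(1)] z(1)] by blast
  qed
  obtain x where x: "x \<in> P" "(lam a ^^ (p * q)) b = x \<otimes> b [^] (v ^ (p * q))"
    using iter by blast
  have "a [^]\<^bsub>C\<^esub> (p * q) = \<one>"
    using C.pow_order_eq_1[of a] a C.order_pq by (simp add: carrier_C one_C)
  \<comment> \<open>The iterate number p q of \<open>lam a\<close> is the identity, since p q is the
    order of \<open>C\<close>.\<close>
  then have "x \<otimes> b [^] (v ^ (p * q)) = \<one> \<otimes> b [^] (1::nat)"
    using x(2) lam_C_pow[OF a b, of "p * q"] b by simp
  then have "[v ^ (p * q) = 1] (mod q)"
    using coset_powers_eq[OF subgroup_P b False pow_q_in_P[OF b] q] x(1) P_closed(3) by blast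
  then have "[v = 1] (mod q)"
    using pow_cong_1_imp_cong_1[OF p q qp] by blast
  then obtain r where "v = 1 + q * r"
  proof (cases "v = 0")
    case True
    with \<open>[v = 1] (mod q)\<close> show ?thesis
      using pq_gt(2) by (simp add: cong_def)
  next
    case False
    with \<open>[v = 1] (mod q)\<close> show ?thesis
      using that by (metis One_nat_def Suc_leI add.commute bot_nat_0.not_eq_extremum cong_le_nat mult.commute)
  qed
  then have "b [^] v = (b [^] q) [^] r \<otimes> b"
    using b by (simp add: nat_pow_pow nat_pow_mult[symmetric] nat_pow_comm)
  then have "lam a b = (y \<otimes> (b [^] q) [^] r) \<otimes> b"
    using y b by (simp add: P_carrier m_assoc)
  moreover have "y \<otimes> (b [^] q) [^] r \<in> P"
    using P_closed pow_q_in_P[OF b] y(1) by blast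
  ultimately show thesis
    using that by blast
qed

text \<open>Additively, lam \<tau> \<tau> = f \<sigma> + \<tau> and lam \<tau> \<sigma> = c
  \<sigma>. If c = 1, the error f is already 0. If c - 1 is invertible modulo p, a translation of
  \<tau> by a multiple of \<sigma> removes the error.\<close>

lemma exists_fixed_complement:
  assumes \<sigma>: "\<sigma> \<in> P" "\<sigma> \<noteq> \<one>" and \<tau>: "\<tau> \<in> carrier G" "\<tau> \<noteq> \<one>" "\<tau> [^] q = \<one>"
    and comm: "\<sigma> \<otimes>\<^bsub>C\<^esub> \<tau> = \<sigma> \<otimes> \<tau>"
  obtains \<rho> where "\<rho> \<in> carrier G" "\<rho> \<noteq> \<one>" "\<rho> [^] q = \<one>" "lam \<rho> \<rho> = \<rho>" "lam \<sigma> \<rho> = \<rho>"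
proof -
  note \<sigma>c = P_carrier[OF \<sigma>(1)]
  note eq_iff = generator_P(1)[OF \<sigma>]
  note \<tau>_notin = order_q_notin_P[OF \<tau>]
  have lam_\<sigma>: "lam \<sigma> \<tau> = \<tau>"
    using comm \<sigma>c \<tau>(1) by (simp add: circ_eq)
  have lam_P_\<tau>: "lam x \<tau> = \<tau>" if "x \<in> P" for x
  proof -
    obtain i :: nat where "x = \<sigma> [^] i"
      using generator_P(2)[OF \<sigma> \<open>x \<in> P\<close>] by blast
    then have "x = \<sigma> [^]\<^bsub>C\<^esub> i"
      using C_pow_P[OF \<sigma>(1)] by simp
    then show ?thesis
      using lam_C_pow[OF \<sigma>c \<tau>(1), of i] lam_pow_fix[OF lam_\<sigma>] by simp
  qed
  obtain x where x: "x \<in> P" "lam \<tau> \<tau> = x \<otimes> \<tau>"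
    using lam_coset[OF \<tau>(1) \<tau>(1)] .
  obtain f :: nat where f: "x = \<sigma> [^] f"
    using generator_P(2)[OF \<sigma> x(1)] by blast
  obtain c :: nat where c: "lam \<tau> \<sigma> = \<sigma> [^] c"
    using generator_P(2)[OF \<sigma> lam_P[OF \<tau>(1) \<sigma>(1)]] by blast
  show thesis
  proof (cases "[c = 1] (mod p)")
    case True
    then have lam_\<tau>_\<sigma>: "lam \<tau> \<sigma> = \<sigma>"
      using c eq_iff[of c 1] \<sigma>c by simp
    have iter: "(lam \<tau> ^^ n) \<tau> = \<sigma> [^] (n * f) \<otimes> \<tau>" for n
    proof (induction n)
      case (Suc n)
      then show ?case
        using \<sigma>c \<tau>(1) nat_pow_comm[OF \<sigma>c, of "n * f" f]
        by (simp add: lam_mult lam_pow lam_\<tau>_\<sigma> x(2) f add.commute flip: m_assoc nat_pow_mult)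
    qed (use \<tau>(1) in simp)
    \<comment> \<open>Elements of \<open>P\<close> fix \<tau>, so the q-th iterate of
      \<open>lam \<tau>\<close> fixes \<tau>. By \<open>iter\<close> it adds q f \<sigma>, hence p
      divides q f and therefore f.\<close>
    have "\<tau> [^]\<^bsub>C\<^esub> q \<in> P"
      using C.pow_q_in_P[of \<tau>] \<tau>(1) by (simp add: carrier_C C_P_eq)
    then have "\<sigma> [^] (q * f) \<otimes> \<tau> = \<one> \<otimes> \<tau>"
      using lam_P_\<tau> lam_C_pow[OF \<tau>(1) \<tau>(1), of q] iter[of q] \<tau>(1) by simp
    then have "\<sigma> [^] (q * f) = \<sigma> [^] (0::nat)"
      using \<sigma>c \<tau>(1) by simp
    then have "p dvd q * f"
      unfolding eq_iff by (simp add: cong_0_iff)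
    then have "p dvd f"
      using p q qp by (metis less_irrefl_nat prime_dvd_multD primes_dvd_imp_eq)
    then have "\<sigma> [^] f = \<sigma> [^] (0::nat)"
      unfolding eq_iff by (simp add: cong_0_iff)
    then have "lam \<tau> \<tau> = \<tau>"
      using x f \<tau>(1) by simp
    then show thesis
      using that \<tau> lam_\<sigma> by blast
  next
    case False
    have "coprime (int c - 1) (int p)"
    proof -
      have "\<not> [int c = int 1] (mod int p)"
        using False unfolding cong_int_iff .
      then have "\<not> int p dvd int c - 1"
        by (simp add: cong_iff_dvd_diff)
      then have "coprime (int p) (int c - 1)"
        using p by (intro prime_imp_coprime) auto
      then show ?thesis
        using coprime_commute[THEN iffD1] by blast
    qed
    then obtain y where y: "[(int c - 1) * y = 1] (mod int p)"
      using cong_solve_coprime_int by blast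
    \<comment> \<open>For \<rho> = i \<sigma> + \<tau> one gets lam \<rho> \<rho> = (c i + f)
      \<sigma> + \<tau>. Being fixed thus means (c - 1) i = -f, and y is the inverse of c -
      1.\<close>
    define i where "i = nat ((- (y * int f)) mod int p)"
    have i: "[int i = - (y * int f)] (mod int p)"
      using pq_gt(3) by (simp add: i_def cong_def)
    have "[int (c * i + f) = int i] (mod int p)"
    proof -
      have "[(int c - 1) * int i = (int c - 1) * (- (y * int f))] (mod int p)"
        by (intro cong_mult cong_refl i)
      also have "(int c - 1) * (- (y * int f)) = ((int c - 1) * y) * (- int f)"
        by simp
      also have "[\<dots> = 1 * (- int f)] (mod int p)"
        by (intro cong_mult cong_refl y)
      finally have "[(int c - 1) * int i + (int i + int f) = - int f + (int i + int f)] (mod int p)"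
        by (intro cong_add cong_refl) simp
      then show ?thesis
        by (simp add: algebra_simps)
    qed
    then have ci: "\<sigma> [^] (c * i + f) = \<sigma> [^] i"
      unfolding eq_iff cong_int_iff .
    define \<rho> where "\<rho> = \<sigma> [^] i \<otimes> \<tau>"
    have \<sigma>i: "\<sigma> [^] i \<in> P"
      using P_closed(2)[OF \<sigma>(1)] .
    have \<rho>c: "\<rho> \<in> carrier G"
      using \<sigma>c \<tau>(1) by (simp add: \<rho>_def)
    have lam_P_\<rho>: "lam z \<rho> = \<rho>" if "z \<in> P" for z
      using that \<sigma>c \<tau>(1) lam_P_P[OF that \<sigma>i] lam_P_\<tau> P_carrier[OF that] by (simp add: \<rho>_def lam_mult)
    have \<rho>_circ: "\<rho> = \<sigma> [^] i \<otimes>\<^bsub>C\<^esub> \<tau>"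
      using lam_P_\<tau>[OF \<sigma>i] \<sigma>c \<tau>(1) by (simp add: circ_eq \<rho>_def)
    have lam_\<rho>: "lam \<rho> z = lam (\<sigma> [^] i) (lam \<tau> z)" if "z \<in> carrier G" for z
      unfolding \<rho>_circ using lam_circ[of "\<sigma> [^] i" \<tau> z] that \<sigma>c \<tau>(1) by simp
    have "lam \<tau> \<rho> = \<sigma> [^] (c * i + f) \<otimes> \<tau>"
      using \<sigma>c \<tau>(1)
      by (simp add: \<rho>_def lam_mult lam_pow c x(2) f nat_pow_pow flip: m_assoc nat_pow_mult)
    then have fix\<rho>: "lam \<rho> \<rho> = \<rho>"
      using lam_\<rho>[OF \<rho>c] lam_P_\<rho>[OF \<sigma>i] unfolding ci by (simp flip: \<rho>_def)
    have "\<rho> \<notin> P"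
    proof
      assume "\<rho> \<in> P"
      then have "inv (\<sigma> [^] i) \<otimes> \<rho> \<in> P"
        using subgroup.m_inv_closed[OF subgroup_P \<sigma>i] P_closed(1) by blast
      then show False
        using \<tau>_notin \<sigma>c \<tau>(1) by (simp add: \<rho>_def flip: m_assoc)
    qed
    then have "\<rho> \<noteq> \<one>"
      using P_closed(3) by blast
    obtain j :: nat where j: "\<rho> [^] q = \<sigma> [^] j"
      using generator_P(2)[OF \<sigma> pow_q_in_P[OF \<rho>c]] by blast
    \<comment> \<open>The translation may have spoiled the additive order. But \<rho>^q lies in
      \<open>P\<close>, is fixed by \<open>lam \<rho>\<close>, and \<open>lam \<rho>\<close>
      multiplies exponents of \<sigma> by c; as c - 1 is invertible, \<rho>^q = 1.\<close>
    have "lam \<rho> (\<rho> [^] q) = \<rho> [^] q"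
      using \<rho>c by (simp add: lam_pow fix\<rho>)
    moreover have "lam \<rho> (\<sigma> [^] j) = \<sigma> [^] (c * j)"
      using \<sigma>c \<rho>c \<tau>(1) lam_\<rho>[OF \<sigma>c] lam_P_P[OF \<sigma>i P_closed(2)[OF \<sigma>(1)], of c]
      by (simp add: lam_pow c nat_pow_pow)
    ultimately have "[c * j = j] (mod p)"
      unfolding j by (simp add: eq_iff)
    then have "[int (c * j) = int j] (mod int p)"
      unfolding cong_int_iff .
    then have "int p dvd (int c - 1) * int j"
      by (simp add: cong_iff_dvd_diff algebra_simps)
    then have "int p dvd int j"
      using \<open>coprime (int c - 1) (int p)\<close> by (metis coprime_commute coprime_dvd_mult_right_iff)
    then have "\<sigma> [^] j = \<sigma> [^] (0::nat)"
      unfolding eq_iff by (simp add: cong_0_iff)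
    then have "\<rho> [^] q = \<one>"
      using j by simp
    then show thesis
      using that \<rho>c \<open>\<rho> \<noteq> \<one>\<close> fix\<rho> lam_P_\<rho>[OF \<sigma>(1)] by blast
  qed
qed

text \<open>The normal form map built from \<sigma> and the corrected \<rho> is literally the same
  function in both groups: powers agree, and \<open>lam\<close> of any power of \<sigma> fixes the
  powers of \<rho>. Each group then contributes its own conjugation exponent, h or k.\<close>

lemma coordinates:
  assumes \<sigma>: "\<sigma> \<in> P" "\<sigma> \<noteq> \<one>" and \<tau>: "\<tau> \<in> carrier G" "\<tau> \<noteq> \<one>" "\<tau> [^] q = \<one>"
    and comm: "\<sigma> \<otimes>\<^bsub>C\<^esub> \<tau> = \<sigma> \<otimes> \<tau>"
  obtains h k f where "[int h ^ q = 1] (mod int p)" "[int k ^ q = 1] (mod int p)"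
    "bij_betw f ({0..<int p} \<times> {0..<int q}) (carrier G)"
    "\<forall>x \<in> {0..<int p} \<times> {0..<int q}. \<forall>y \<in> {0..<int p} \<times> {0..<int q}.
      f (twisted_op p q 1 (int h) x y) = f x \<otimes> f y \<and>
      f (twisted_op p q 1 (int k) x y) = f x \<otimes>\<^bsub>C\<^esub> f y"
proof -
  obtain \<rho> where \<rho>: "\<rho> \<in> carrier G" "\<rho> \<noteq> \<one>" "\<rho> [^] q = \<one>"
    and fixed: "lam \<rho> \<rho> = \<rho>" "lam \<sigma> \<rho> = \<rho>"
    using exists_fixed_complement[OF assms] .
  note \<sigma>c = P_carrier[OF \<sigma>(1)]
  have pows: "\<rho> [^]\<^bsub>C\<^esub> n = \<rho> [^] n" "\<sigma> [^]\<^bsub>C\<^esub> n = \<sigma> [^] n" for n :: nat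
    using C_pow_eq[OF \<rho>(1) fixed(1)] C_pow_P[OF \<sigma>(1)] by blast+
  obtain y where y: "y \<in> P" "\<rho> \<otimes> \<sigma> = y \<otimes> \<rho>"
    using conj_P[OF \<sigma>(1) \<rho>(1)] .
  obtain h :: nat where "y = \<sigma> [^] h"
    using generator_P(2)[OF \<sigma> y(1)] by blast
  with y have h: "\<rho> \<otimes> \<sigma> = \<sigma> [^] h \<otimes> \<rho>" by simp
  obtain z where z: "z \<in> P" "\<rho> \<otimes>\<^bsub>C\<^esub> \<sigma> = z \<otimes>\<^bsub>C\<^esub> \<rho>"
    using C.conj_P[of \<sigma> \<rho>] \<sigma>(1) \<rho>(1) unfolding C_P_eq carrier_C by blast
  obtain k :: nat where "z = \<sigma> [^] k"
    using generator_P(2)[OF \<sigma> z(1)] by blast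
  with z have k: "\<rho> \<otimes>\<^bsub>C\<^esub> \<sigma> = \<sigma> [^]\<^bsub>C\<^esub> k \<otimes>\<^bsub>C\<^esub> \<rho>"
    by (simp add: pows)
  have \<rho>_C: "\<sigma> \<in> C.P" "\<sigma> \<noteq> \<one>\<^bsub>C\<^esub>" "\<rho> \<in> carrier C" "\<rho> \<noteq> \<one>\<^bsub>C\<^esub>" "\<rho> [^]\<^bsub>C\<^esub> q = \<one>\<^bsub>C\<^esub>"
    using \<sigma> \<rho> by (simp_all add: C_P_eq one_C carrier_C pows)
  have coord_eq: "C.coord \<sigma> \<rho> = coord \<sigma> \<rho>"
  proof -
    have "\<sigma> [^] i \<otimes>\<^bsub>C\<^esub> \<rho> [^] j = \<sigma> [^] i \<otimes> \<rho> [^] j" for i j :: nat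
    proof -
      have "lam (\<sigma> [^] i) \<rho> = \<rho>"
        using lam_C_pow[OF \<sigma>c \<rho>(1), of i] lam_pow_fix[OF fixed(2)] by (simp add: pows)
      then show ?thesis
        using \<sigma>c \<rho>(1) by (simp add: circ_eq lam_pow)
    qed
    then show ?thesis
      by (simp add: coord_def C.coord_def pows)
  qed
  show thesis
    by (rule that[OF conj_exponent_unity[OF \<sigma> \<rho> h] C.conj_exponent_unity[OF \<rho>_C k] coord_bij[OF \<sigma> \<rho> h]])
      (simp add: coord_mult[OF \<sigma> \<rho> h] C.coord_mult[OF \<rho>_C k, unfolded coord_eq])
qed

text \<open>In additive exponents, \<sigma> o \<tau> = (1 + d) \<sigma> + \<tau>. Two congruences
  modulo p govern d: c d = k d and h c = k (1 + d). Either d = 0, or c = k is invertible and h = 1 +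
  d, so that \<sigma> o \<tau> = h \<sigma> + \<tau> = \<tau> + \<sigma>.\<close>

lemma circ_eq_add_or_opposite:
  assumes \<sigma>: "\<sigma> \<in> P" "\<sigma> \<noteq> \<one>" and \<tau>: "\<tau> \<in> carrier G"
  shows "\<sigma> \<otimes>\<^bsub>C\<^esub> \<tau> = \<sigma> \<otimes> \<tau> \<or> \<sigma> \<otimes>\<^bsub>C\<^esub> \<tau> = \<tau> \<otimes> \<sigma>"
proof -
  note \<sigma>c = P_carrier[OF \<sigma>(1)]
  note eq_iff = generator_P(1)[OF \<sigma>]
  have pow: "\<exists>i::nat. x = \<sigma> [^] i" if "x \<in> P" for x
    using generator_P(2)[OF \<sigma> that] .
  obtain d :: nat where d: "lam \<sigma> \<tau> = \<sigma> [^] d \<otimes> \<tau>"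
    using lam_coset[OF \<sigma>c \<tau>] pow by metis
  obtain f :: nat where f: "lam \<tau> \<tau> = \<sigma> [^] f \<otimes> \<tau>"
    using lam_coset[OF \<tau> \<tau>] pow by metis
  obtain c :: nat where c: "lam \<tau> \<sigma> = \<sigma> [^] c"
    using pow[OF lam_P[OF \<tau> \<sigma>(1)]] by blast
  obtain h :: nat where h: "\<tau> \<otimes> \<sigma> = \<sigma> [^] h \<otimes> \<tau>"
    using conj_P[OF \<sigma>(1) \<tau>] pow by metis
  have "\<exists>y\<in>P. \<tau> \<otimes>\<^bsub>C\<^esub> \<sigma> = y \<otimes>\<^bsub>C\<^esub> \<tau>"
    using C.conj_P[of \<sigma> \<tau>] \<sigma>(1) \<tau> unfolding C_P_eq carrier_C by blast
  then obtain k :: nat where k: "\<tau> \<otimes>\<^bsub>C\<^esub> \<sigma> = \<sigma> [^] k \<otimes>\<^bsub>C\<^esub> \<tau>"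
    using pow by blast
  have lam_\<sigma>\<sigma>: "lam \<sigma> \<sigma> = \<sigma>"
    using lam_P_P \<sigma>(1) by blast
  have iter: "(lam \<sigma> ^^ n) \<tau> = \<sigma> [^] (n * d) \<otimes> \<tau>" for n
  proof (induction n)
    case (Suc n)
    then show ?case
      using \<sigma>c \<tau> nat_pow_comm[OF \<sigma>c, of "n * d" d]
      by (simp add: lam_mult lam_pow lam_\<sigma>\<sigma> d add.commute flip: m_assoc nat_pow_mult)
  qed (use \<tau> in simp)
  have lam_k: "lam (\<sigma> [^] k) \<tau> = \<sigma> [^] (k * d) \<otimes> \<tau>"
    using lam_C_pow[OF \<sigma>c \<tau>, of k] C_pow_P[OF \<sigma>(1)] iter by simp
  \<comment> \<open>The element \<tau> o \<sigma> = k \<sigma> o \<tau> acts on \<tau> in two ways.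
    The term f occurs on both sides and cancels, leaving c d = k d.\<close>
  have "\<sigma> [^] (c * d + f) \<otimes> \<tau> = lam \<tau> (lam \<sigma> \<tau>)"
    using \<sigma>c \<tau> by (simp add: d lam_mult lam_pow c f nat_pow_pow flip: m_assoc nat_pow_mult)
  also have "\<dots> = lam (\<sigma> [^] k) (lam \<tau> \<tau>)"
    using \<sigma>c \<tau> by (simp add: k flip: lam_circ)
  also have "\<dots> = \<sigma> [^] (f + k * d) \<otimes> \<tau>"
    using \<sigma>c \<tau> lam_P_P[OF P_closed(2)[OF \<sigma>(1)] P_closed(2)[OF \<sigma>(1)], of k f]
    by (simp add: f lam_mult lam_k flip: m_assoc nat_pow_mult)
  finally have "\<sigma> [^] (c * d + f) = \<sigma> [^] (f + k * d)"
    using \<sigma>c \<tau> by simp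
  then have cd: "[c * d = k * d] (mod p)"
    unfolding eq_iff by (simp add: add.commute cong_add_lcancel_nat)
  \<comment> \<open>The second congruence expresses \<tau> o \<sigma> once through the additive and
    once through the circle conjugation exponent.\<close>
  have "\<sigma> [^] (h * c) \<otimes> \<tau> = \<tau> \<otimes>\<^bsub>C\<^esub> \<sigma>"
    using pow_conj[OF \<sigma>c \<tau> h, of 1 c] \<sigma>c \<tau> by (simp add: circ_eq c)
  also have "\<dots> = \<sigma> [^] (k + k * d) \<otimes> \<tau>"
    unfolding k using \<sigma>c \<tau> by (simp add: circ_eq lam_k flip: m_assoc nat_pow_mult)
  finally have "\<sigma> [^] (h * c) = \<sigma> [^] (k + k * d)"
    using \<sigma>c \<tau> by simp
  then have hc: "[h * c = k + k * d] (mod p)"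
    unfolding eq_iff .
  have circ: "\<sigma> \<otimes>\<^bsub>C\<^esub> \<tau> = \<sigma> [^] (1 + d) \<otimes> \<tau>"
    using \<sigma>c \<tau> nat_pow_Suc2[OF \<sigma>c, of d] by (simp add: circ_eq d flip: m_assoc)
  show ?thesis
  proof (cases "p dvd d")
    case True
    then have "\<sigma> [^] (1 + d) = \<sigma> [^] (1::nat)"
      unfolding eq_iff using cong_add[OF cong_refl[of 1 p], of d 0] by (simp add: cong_0_iff)
    then show ?thesis
      using circ \<sigma>c by simp
  next
    case False
    then have "coprime d p"
      using prime_imp_coprime[OF p] coprime_commute[THEN iffD1] by blast
    then have ck: "[c = k] (mod p)"
      using cd by (simp add: cong_mult_rcancel_nat)
    have "\<not> p dvd c"
    proof
      assume "p dvd c"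
      then have "\<sigma> [^] c = \<sigma> [^] (0::nat)"
        unfolding eq_iff by (simp add: cong_0_iff)
      then have "lam \<tau> \<sigma> = lam \<tau> \<one>"
        using c \<tau> by simp
      then show False
        using lam_inj[OF \<tau> \<sigma>c] \<sigma>(2) by simp
    qed
    then have "coprime c p"
      using prime_imp_coprime[OF p] coprime_commute[THEN iffD1] by blast
    moreover have "[h * c = (1 + d) * c] (mod p)"
    proof -
      have "[k * (1 + d) = c * (1 + d)] (mod p)"
        by (intro cong_mult cong_refl cong_sym[OF ck])
      then show ?thesis
        using cong_trans[OF hc, of "c * (1 + d)"] by (simp add: algebra_simps)
    qed
    ultimately have "[h = 1 + d] (mod p)"
      by (simp only: cong_mult_rcancel_nat)
    then have "\<sigma> [^] h = \<sigma> [^] (1 + d)"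
      unfolding eq_iff .
    then show ?thesis
      using circ h by simp
  qed
qed

end

section \<open>Classification\<close>

definition opposite :: "('a, 'b) monoid_scheme \<Rightarrow> 'a monoid" where
  "opposite G = \<lparr>carrier = carrier G, monoid.mult = (\<lambda>x y. y \<otimes>\<^bsub>G\<^esub> x), monoid.one = \<one>\<^bsub>G\<^esub>\<rparr>"

lemma opposite_simps [simp]:
  "carrier (opposite G) = carrier G"
  "monoid.mult (opposite G) x y = y \<otimes>\<^bsub>G\<^esub> x"
  "monoid.one (opposite G) = \<one>\<^bsub>G\<^esub>"
  by (simp_all add: opposite_def)

context group
begin

lemma group_opposite: "group (opposite G)"
  by (rule groupI) (auto simp: m_assoc intro: r_inv_ex)

lemma opposite_inv: "x \<in> carrier G \<Longrightarrow> inv\<^bsub>opposite G\<^esub> x = inv x"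
  using group.inv_equality[OF group_opposite, of "inv x" x] by simp

lemma opposite_pow: "x \<in> carrier G \<Longrightarrow> x [^]\<^bsub>opposite G\<^esub> (n::nat) = x [^] n"
proof (induction n)
  case (Suc n)
  then show ?case
    using nat_pow_Suc2[of x n] by (simp add: nat_pow_def)
qed (simp add: nat_pow_def)

end

text \<open>Reversing the addition turns the brace law into the same law with b and c
  interchanged.\<close>

lemma (in pq_brace) pq_brace_opposite: "pq_brace (opposite G) C p q"
proof -
  interpret op: group "opposite G"
    by (rule group_opposite)
  show ?thesis
    by unfold_locales
      (use p q qp order_pq in \<open>simp_all add: order_def carrier_C law opposite_inv m_assoc\<close>)
qed

lemma (in pq_brace) opposite_P: "pq_group.P (opposite G) p = P"
proof -
  interpret op: pq_brace "opposite G" C p q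
    by (rule pq_brace_opposite)
  show ?thesis
    unfolding op.P_def P_def by (auto simp: opposite_pow)
qed

lemma skew_brace_pq_brace:
  assumes "skew_brace A" and "prime p" and "prime q" and "q < p" and "order A = p * q"
  shows "pq_brace (add_monoid A) A p q"
proof -
  interpret add: group "add_monoid A"
    by (rule skew_brace.additive_group) fact
  interpret circ: group A
    by (rule skew_brace.circle_group) fact
  show ?thesis
    by unfold_locales
      (use assms skew_brace.brace_law[OF assms(1)] in \<open>simp_all add: order_def a_minus_def a_inv_def\<close>)
qed

lemma skew_brace_iso_model_brace:
  assumes A: "skew_brace A" and p: "prime p" and q: "prime q" and qp: "q < p"
    and ord: "order A = p * q"
  obtains h a k where "[h ^ q = 1] (mod int p)" "[k ^ q = 1] (mod int p)" "a = 1 \<or> a = h"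
    "model_brace p q h a k \<cong>\<^sub>b A"
proof -
  let ?S = "{0..<int p} \<times> {0..<int q}"
  interpret pq_brace "add_monoid A" A p q
    using skew_brace_pq_brace[OF A p q qp ord] .
  obtain \<sigma> where \<sigma>: "\<sigma> \<in> P" "\<sigma> \<noteq> \<one>\<^bsub>add_monoid A\<^esub>"
  proof -
    have "\<not> P \<subseteq> {\<one>\<^bsub>add_monoid A\<^esub>}"
      using card_P pq_gt(1) card_mono[of "{\<one>\<^bsub>add_monoid A\<^esub>}" P] by auto
    then show thesis
      using that by blast
  qed
  obtain \<tau> where \<tau>: "\<tau> \<in> carrier (add_monoid A)" "\<tau> \<noteq> \<one>\<^bsub>add_monoid A\<^esub>"
    "\<tau> [^]\<^bsub>add_monoid A\<^esub> q = \<one>\<^bsub>add_monoid A\<^esub>"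
    using exists_order_q .
  consider (same) "\<sigma> \<otimes>\<^bsub>A\<^esub> \<tau> = \<sigma> \<otimes>\<^bsub>add_monoid A\<^esub> \<tau>" | (op) "\<sigma> \<otimes>\<^bsub>A\<^esub> \<tau> = \<tau> \<otimes>\<^bsub>add_monoid A\<^esub> \<sigma>"
    using circ_eq_add_or_opposite[OF \<sigma> \<tau>(1)] by blast
  then show thesis
  proof cases
    case same
    obtain h k f where hk: "[int h ^ q = 1] (mod int p)" "[int k ^ q = 1] (mod int p)"
      and f: "bij_betw f ?S (carrier (add_monoid A))"
        "\<forall>x\<in>?S. \<forall>y\<in>?S. f (twisted_op p q 1 (int h) x y) = f x \<otimes>\<^bsub>add_monoid A\<^esub> f y \<and>
          f (twisted_op p q 1 (int k) x y) = f x \<otimes>\<^bsub>A\<^esub> f y"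
      using coordinates[OF \<sigma> \<tau> same] .
    have "model_brace p q (int h) 1 (int k) \<cong>\<^sub>b A"
      by (intro isomorphic_skew_bracesI[of f]) (use f(1) in \<open>simp_all add: f(2)[THEN bspec, THEN bspec]\<close>)
    then show thesis
      using that[OF hk] by blast
  next
    case op
    interpret op: pq_brace "opposite (add_monoid A)" A p q
      by (rule pq_brace_opposite)
    have \<sigma>': "\<sigma> \<in> op.P" "\<sigma> \<noteq> \<one>\<^bsub>opposite (add_monoid A)\<^esub>"
      using \<sigma> unfolding opposite_P by simp_all
    have \<tau>': "\<tau> \<in> carrier (opposite (add_monoid A))" "\<tau> \<noteq> \<one>\<^bsub>opposite (add_monoid A)\<^esub>"
      "\<tau> [^]\<^bsub>opposite (add_monoid A)\<^esub> q = \<one>\<^bsub>opposite (add_monoid A)\<^esub>"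
      using \<tau> opposite_pow[OF \<tau>(1), of q] by simp_all
    have comm': "\<sigma> \<otimes>\<^bsub>A\<^esub> \<tau> = \<sigma> \<otimes>\<^bsub>opposite (add_monoid A)\<^esub> \<tau>"
      using op by simp
    obtain h k f where h: "[int h ^ q = 1] (mod int p)" and k: "[int k ^ q = 1] (mod int p)"
      and f: "bij_betw f ?S (carrier (opposite (add_monoid A)))"
        "\<forall>x\<in>?S. \<forall>y\<in>?S.
          f (twisted_op p q 1 (int h) x y) = f x \<otimes>\<^bsub>opposite (add_monoid A)\<^esub> f y \<and>
          f (twisted_op p q 1 (int k) x y) = f x \<otimes>\<^bsub>A\<^esub> f y"
      using op.coordinates[OF \<sigma>' \<tau>' comm'] .
    \<comment> \<open>The inverse of h modulo p, available as a power because h^q = 1; it is the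
      conjugation exponent in the original additive group.\<close>
    define h' where "h' = int h ^ (q - 1)"
    have h'h: "[h' * int h = 1] (mod int p)"
      using h pq_gt(4) unfolding h'_def by (metis power_minus_mult)
    have h': "[h' ^ q = 1] (mod int p)"
      using cong_pow[OF h, of "q - 1"] by (simp add: h'_def mult.commute flip: power_mult)
    \<comment> \<open>Rescaling by h^m multiplies both parameters of a \<open>twisted_op\<close> by
      h, which is the content of \<open>\<theta>_op\<close>.\<close>
    define \<theta> :: "int \<times> int \<Rightarrow> int \<times> int" where "\<theta> = (\<lambda>(n, m). (int h ^ nat m * n mod int p, m))"
    have \<theta>_S: "\<theta> x \<in> ?S" if "x \<in> ?S" for x
      using that pq_gt(3) by (auto simp: \<theta>_def)
    have \<theta>_op: "\<theta> (twisted_op p q b c x y) = twisted_op p q b' c' (\<theta> x) (\<theta> y)"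
      if b: "[b * int h = b'] (mod int p)" and c: "[c * int h = c'] (mod int p)"
        and xy: "x \<in> ?S" "y \<in> ?S" for b c b' c' x y
    proof -
      obtain n m s t where nm: "x = (n, m)" "y = (s, t)" "m \<ge> 0" "t \<ge> 0"
        using xy by (cases x; cases y) auto
      have "[int h ^ nat ((m + t) mod int q) * ((b ^ nat t * n + c ^ nat m * s) mod int p)
          = (int h ^ nat m * int h ^ nat t) * (b ^ nat t * n + c ^ nat m * s)] (mod int p)"
        by (intro cong_mult pow_nat_add_mod_cong h nm) (simp add: cong_def)
      also have "(int h ^ nat m * int h ^ nat t) * (b ^ nat t * n + c ^ nat m * s)
          = (b * int h) ^ nat t * (int h ^ nat m * n) + (c * int h) ^ nat m * (int h ^ nat t * s)"
        by (simp add: algebra_simps)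
      also have "[\<dots> = b' ^ nat t * (int h ^ nat m * n mod int p)
          + c' ^ nat m * (int h ^ nat t * s mod int p)] (mod int p)"
        by (intro cong_add cong_mult cong_pow b c) (simp_all add: cong_def)
      finally show ?thesis
        by (simp add: nm twisted_op_simp \<theta>_def cong_def)
    qed
    have \<theta>_bij: "bij_betw \<theta> ?S ?S"
    proof (rule bij_betw_endo)
      show "inj_on \<theta> ?S"
      proof (rule inj_onI)
        fix x y
        assume xy: "x \<in> ?S" "y \<in> ?S" "\<theta> x = \<theta> y"
        obtain n m s t where nm: "x = (n, m)" "y = (s, t)" by fastforce
        have "m = t" "[int h ^ nat m * n = int h ^ nat m * s] (mod int p)"
          using xy(3) by (auto simp: nm \<theta>_def cong_def)
        moreover have "coprime (int h) (int p)"
          using h'h by (metis cong_imp_coprime cong_sym coprime_1_left coprime_mult_left_iff)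
        ultimately have "[n = s] (mod int p)"
          by (simp add: cong_mult_lcancel)
        then show "x = y"
          using xy(1,2) \<open>m = t\<close> by (simp add: nm cong_def)
      qed
    qed (use \<theta>_S in auto)
    \<comment> \<open>Under \<theta> the additive parameters (1, h') become (h, 1), the reversed
      semidirect product, and the circle parameters (h', k h') become (1, k). This dictates the
      three parameters.\<close>
    have "model_brace p q h' h' (int k * h') \<cong>\<^sub>b A"
    proof (rule isomorphic_skew_bracesI[of "f \<circ> \<theta>"])
      show "bij_betw (f \<circ> \<theta>) (carrier (model_brace p q h' h' (int k * h'))) (carrier A)"
        using bij_betw_trans[OF \<theta>_bij f(1)] by simp
    next
      fix x y
      assume "x \<in> carrier (model_brace p q h' h' (int k * h'))"
        "y \<in> carrier (model_brace p q h' h' (int k * h'))"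
      then have xy: "x \<in> ?S" "y \<in> ?S" by simp_all
      have "\<theta> (twisted_op p q 1 h' x y) = twisted_op p q (int h) 1 (\<theta> x) (\<theta> y)"
        using xy h'h by (intro \<theta>_op) simp_all
      also have "\<dots> = twisted_op p q 1 (int h) (\<theta> y) (\<theta> x)"
        by (simp add: twisted_op_def split_beta add.commute)
      finally show "(f \<circ> \<theta>) (x \<oplus>\<^bsub>model_brace p q h' h' (int k * h')\<^esub> y) = (f \<circ> \<theta>) x \<oplus>\<^bsub>A\<^esub> (f \<circ> \<theta>) y"
        using \<theta>_S[OF xy(1)] \<theta>_S[OF xy(2)] by (simp add: f(2)[THEN bspec, THEN bspec])
      have "[int k * h' * int h = int k * 1] (mod int p)"
        unfolding mult.assoc by (intro cong_mult cong_refl h'h)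
      then have "\<theta> (twisted_op p q h' (int k * h') x y) = twisted_op p q 1 (int k) (\<theta> x) (\<theta> y)"
        using xy h'h by (intro \<theta>_op) simp_all
      then show "(f \<circ> \<theta>) (x \<otimes>\<^bsub>model_brace p q h' h' (int k * h')\<^esub> y) = (f \<circ> \<theta>) x \<otimes>\<^bsub>A\<^esub> (f \<circ> \<theta>) y"
        using \<theta>_S[OF xy(1)] \<theta>_S[OF xy(2)] by (simp add: f(2)[THEN bspec, THEN bspec])
    qed
    moreover have "[(int k * h') ^ q = 1] (mod int p)"
      using cong_mult[OF k h'] by (simp add: power_mult_distrib)
    ultimately show thesis
      using that[OF h'] by blast
  qed
qed

text \<open>The order of h modulo p divides both q and p - 1, and q does not divide p - 1.\<close>

lemma unity_root_trivial:
  fixes h :: int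
  assumes p: "prime p" and q: "prime q" and pq: "\<not> [p = 1] (mod q)" and h: "[h ^ q = 1] (mod int p)"
  shows "[h = 1] (mod int p)"
proof -
  have p1: "p > 1" and q1: "q > 1" using p q prime_gt_1_nat by blast+
  define n where "n = nat (h mod int p)"
  have hn: "[h = int n] (mod int p)"
    using p1 by (simp add: n_def cong_def)
  have "[int (n ^ q) = int 1] (mod int p)"
    using cong_trans[OF cong_sym[OF cong_pow[OF hn, of q]] h] by simp
  then have nq: "[n ^ q = 1] (mod p)"
    unfolding cong_int_iff .
  have dq: "ord p n dvd q"
    using nq unfolding ord_divides .
  then have "ord p n \<noteq> 0"
    using q1 by (metis dvd_0_left_iff not_less_zero)
  then have "ord p n dvd p - 1"
    using order_divides_totient[of p n] ord_eq_0[of p n] p by (simp add: totient_prime)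
  moreover have "\<not> q dvd p - 1"
    using pq p1 cong_altdef_nat[of 1 p q] cong_sym by (metis less_imp_le_nat)
  ultimately have "ord p n = 1"
    using dq q unfolding prime_nat_iff by metis
  then have "[n = 1] (mod p)"
    using ord[of n p] by simp
  then have "[int n = int 1] (mod int p)"
    unfolding cong_int_iff .
  then show ?thesis
    using cong_trans[OF hn] by simp
qed

lemma ord_of_nat: "ord (int n) (int a) = ord n a"
proof -
  have "[int a ^ d = 1] (mod int n) \<longleftrightarrow> [a ^ d = 1] (mod n)" for d
    using cong_int_iff[of "a ^ d" 1 n] by simp
  then show ?thesis
    by (simp add: ord_def)
qed

lemma skew_brace_param_brace:
  assumes "p > 0" "q > 1" "[g ^ q = 1] (mod int p)" "x \<in> set (pq_params q)"
  shows "skew_brace (param_brace p q g x)"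
proof -
  have pow: "[(g ^ i) ^ q = 1] (mod int p)" for i
    using cong_pow[OF assms(3), of i] by (simp add: mult.commute flip: power_mult)
  obtain i l j where x: "x = (i, l, j)" "l = 0 \<or> l = i"
    using assms(2,4) by (auto simp: set_pq_params le_Suc_eq)
  then show ?thesis
    using assms(1,2) pow by (auto simp: param_brace_def intro!: skew_brace_model_brace)
qed

theorem mainTheorem1:
  fixes p q :: nat
  assumes "prime p" and "prime q" and "p > q"
  shows
    "(\<not> [p = 1] (mod q) \<longrightarrow>
        trivial_skew_brace (brace_a_i p q) \<and> order (brace_a_i p q) = p * q \<and>
        (\<forall>A :: 'a ring. skew_brace A \<and> order A = p * q \<longrightarrow>
           trivial_skew_brace A \<and> A \<cong>\<^sub>b brace_a_i p q))
     \<and>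
     ([p = 1] (mod q) \<longrightarrow>
        (\<forall>g :: int. g \<in> {0..<int p} \<and> ord (int p) g = q \<longrightarrow>
           length (pq_braces p q g) = 2 * q + 2 \<and>
           (\<forall>B \<in> set (pq_braces p q g). skew_brace B \<and> order B = p * q) \<and>
           trivial_skew_brace (brace_a_i p q) \<and>
           bi_skew_brace (brace_a_ii p q g) \<and>
           trivial_skew_brace (brace_b_i p q g) \<and>
           (\<forall>\<gamma> :: nat. 1 < \<gamma> \<and> \<gamma> \<le> q \<longrightarrow> bi_skew_brace (brace_b_iii p q g \<gamma>)) \<and>
           (\<forall>i < length (pq_braces p q g). \<forall>j < length (pq_braces p q g).
              i \<noteq> j \<longrightarrow> \<not> pq_braces p q g ! i \<cong>\<^sub>b pq_braces p q g ! j) \<and>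
           (\<forall>A :: 'a ring. skew_brace A \<and> order A = p * q \<longrightarrow>
              (\<exists>!i. i < length (pq_braces p q g) \<and> A \<cong>\<^sub>b pq_braces p q g ! i))))"
proof -
  note p = assms(1) and q = assms(2) and qp = assms(3)
  have pq0: "p > 0" "q > 0" and q1: "q > 1"
    using p q prime_gt_0_nat prime_gt_1_nat by blast+
  have a_i: "trivial_skew_brace (brace_a_i p q)"
    using pq0 by (simp add: pq_braces_eq trivial_model_brace)
  have "trivial_skew_brace A \<and> A \<cong>\<^sub>b brace_a_i p q"
    if npq: "\<not> [p = 1] (mod q)" and A: "skew_brace A" "order A = p * q" for A :: "'a ring"
  proof -
    obtain h a k where hak: "[h ^ q = 1] (mod int p)" "[k ^ q = 1] (mod int p)" "a = 1 \<or> a = h"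
      "model_brace p q h a k \<cong>\<^sub>b A"
      using skew_brace_iso_model_brace[OF A(1) p q qp A(2)] .
    \<comment> \<open>All q-th roots of unity modulo p are 1 here, so the model coincides with the
      trivial brace as a record.\<close>
    then have "model_brace p q h a k = brace_a_i p q"
      using unity_root_trivial[OF p q npq] unfolding pq_braces_eq[OF pq0]
      by (intro model_brace_cong) auto
    then have "A \<cong>\<^sub>b brace_a_i p q"
      using isomorphic_skew_braces_sym[of "brace_a_i p q" A] hak(4) a_i
      by (simp add: trivial_skew_brace_def)
    then show ?thesis
      using trivial_skew_brace_iso[OF A(1) _ a_i] by blast
  qed
  moreover have "order (brace_a_i p q) = p * q"
    using pq0 by (simp add: pq_braces_eq order_model_brace)
  moreover have
    "length (pq_braces p q g) = 2 * q + 2 \<and>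
     (\<forall>B \<in> set (pq_braces p q g). skew_brace B \<and> order B = p * q) \<and>
     trivial_skew_brace (brace_a_i p q) \<and>
     bi_skew_brace (brace_a_ii p q g) \<and>
     trivial_skew_brace (brace_b_i p q g) \<and>
     (\<forall>\<gamma> :: nat. 1 < \<gamma> \<and> \<gamma> \<le> q \<longrightarrow> bi_skew_brace (brace_b_iii p q g \<gamma>)) \<and>
     (\<forall>i < length (pq_braces p q g). \<forall>j < length (pq_braces p q g).
        i \<noteq> j \<longrightarrow> \<not> pq_braces p q g ! i \<cong>\<^sub>b pq_braces p q g ! j) \<and>
     (\<forall>A :: 'a ring. skew_brace A \<and> order A = p * q \<longrightarrow>
        (\<exists>!i. i < length (pq_braces p q g) \<and> A \<cong>\<^sub>b pq_braces p q g ! i))"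
    if "g \<in> {0..<int p}" "ord (int p) g = q" for g
  proof -
    define g' where "g' = nat g"
    have g': "g = int g'"
      using that(1) by (simp add: g'_def)
    have ord: "ord p g' = q"
      using that(2) by (simp add: g' ord_of_nat)
    have "[int (g' ^ q) = int 1] (mod int p)"
      unfolding cong_int_iff using Pocklington.ord[of g' p] ord by simp
    then have gq: "[g ^ q = 1] (mod int p)"
      by (simp add: g')
    have pow: "[(g ^ i) ^ q = 1] (mod int p)" for i
      using cong_pow[OF gq, of i] by (simp add: mult.commute flip: power_mult)
    note list = pq_braces_params[OF pq0, of g]
    have len: "length (pq_braces p q g) = 2 * q + 2"
      using q1 by (simp add: list length_pq_params)
    have brace: "skew_brace (param_brace p q g x)" if "x \<in> set (pq_params q)" for x
      using skew_brace_param_brace[OF pq0(1) q1 gq that] .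
    have noniso: "x = y"
      if "x \<in> set (pq_params q)" "y \<in> set (pq_params q)" "param_brace p q g x \<cong>\<^sub>b param_brace p q g y" for x y
      using param_brace_noniso[OF p q qp ord that(1,2)] that isomorphic_skew_braces_sym[OF brace]
      unfolding g' by blast
    \<comment> \<open>Isomorphic entries have equal exponent triples, and the triples are pairwise
      distinct, so the positions agree; this excludes repetitions in the list as well.\<close>
    have index_eq: "i = j"
      if ij: "i < length (pq_braces p q g)" "j < length (pq_braces p q g)"
        "pq_braces p q g ! i \<cong>\<^sub>b pq_braces p q g ! j" for i j
    proof -
      have "pq_params q ! i = pq_params q ! j"
        using ij by (intro noniso) (simp_all add: list)
      then show ?thesis
        using ij distinct_pq_params by (simp add: list nth_eq_iff_index_eq)
    qed
    have exists: "\<exists>!i. i < length (pq_braces p q g) \<and> A \<cong>\<^sub>b pq_braces p q g ! i"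
      if A: "skew_brace A" "order A = p * q" for A :: "'a ring"
    proof -
      obtain h a k where hak: "[h ^ q = 1] (mod int p)" "[k ^ q = 1] (mod int p)" "a = 1 \<or> a = h"
        "model_brace p q h a k \<cong>\<^sub>b A"
        using skew_brace_iso_model_brace[OF A(1) p q qp A(2)] .
      obtain x where x: "x \<in> set (pq_params q)" "param_brace p q g x \<cong>\<^sub>b model_brace p q h a k"
        using model_brace_in_params[OF p q ord hak(1-3)] unfolding g' by blast
      have "A \<cong>\<^sub>b param_brace p q g x"
        using isomorphic_skew_braces_sym[OF brace[OF x(1)] isomorphic_skew_braces_trans[OF x(2) hak(4)]] .
      moreover obtain i where "i < length (pq_params q)" "pq_params q ! i = x"
        using x(1) by (auto simp: in_set_conv_nth)
      ultimately have i: "i < length (pq_braces p q g)" "A \<cong>\<^sub>b pq_braces p q g ! i"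
        by (simp_all add: list)
      show ?thesis
      proof (rule ex1I[of _ i])
        fix j
        assume j: "j < length (pq_braces p q g) \<and> A \<cong>\<^sub>b pq_braces p q g ! j"
        have "pq_braces p q g ! i \<cong>\<^sub>b pq_braces p q g ! j"
          using isomorphic_skew_braces_trans[OF isomorphic_skew_braces_sym[OF A(1) i(2)]] j by blast
        then show "j = i"
          using index_eq[OF i(1), of j] j by simp
      qed (use i in simp)
    qed
    have "skew_brace B \<and> order B = p * q" if "B \<in> set (pq_braces p q g)" for B
      using that brace by (auto simp: list) (simp add: param_brace_def order_model_brace)
    moreover have "bi_skew_brace (brace_a_ii p q g)"
      using pq0 gq by (simp add: pq_braces_eq bi_skew_brace_model_brace)
    moreover have "trivial_skew_brace (brace_b_i p q g)"
      using pq0 gq by (simp add: pq_braces_eq trivial_model_brace)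
    moreover have "bi_skew_brace (brace_b_iii p q g \<gamma>)" for \<gamma>
      using pq0 gq pow by (simp add: pq_braces_eq bi_skew_brace_model_brace)
    ultimately show ?thesis
      using len a_i index_eq exists by blast
  qed
  ultimately show ?thesis
    using a_i by blast
qed

end
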